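(* For every finite simple graph $G$, $\chi(G)\le\frac{6}{5}\,\omega(D(G))+\frac{3}{5}$.
   Context: All graphs are finite and simple. $D(G)$ is the degree sequence of $G$; for a degree sequence $D$, $\omega(D)$ is the maximum clique number $\omega(H)$ over all simple graphs $H$ whose degree sequence is $D$. $\chi(G)$ is the chromatic number of $G$. *)

theory Defs
  imports Complex_Main "HOL-Library.Multiset" "HOL-Library.Ramsey"
begin

text \<open>A graph is a pair of a vertex set \<open>V\<close> and a set \<open>E\<close> of two-element subsets of \<open>V\<close>.\<close>

definition simple_graph :: "'a set \<Rightarrow> 'a set set \<Rightarrow> bool" where
  "simple_graph V E \<longleftrightarrow> finite V \<and> E \<subseteq> [V]\<^bsup>2\<^esup>"

definition degree :: "'a set set \<Rightarrow> 'a \<Rightarrow> nat" where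
  "degree E v = card {e \<in> E. v \<in> e}"

text \<open>Degree sequences are written in nonincreasing order.\<close>

definition degree_sequence :: "'a set \<Rightarrow> 'a set set \<Rightarrow> nat list" where
  "degree_sequence V E = rev (sorted_list_of_multiset (image_mset (degree E) (mset_set V)))"

definition clique_number :: "'a set \<Rightarrow> 'a set set \<Rightarrow> nat" where
  "clique_number V E = Max {card K | K. K \<subseteq> V \<and> clique K E}"

text \<open>
  The graphs realizing \<open>D\<close> range over vertex sets in \<^typ>\<open>nat\<close>; every finite graph is
  isomorphic to one of these. The value is meaningful only if \<open>D\<close> is realizable,
  since otherwise the maximum is over the empty set.
\<close>

definition seq_clique_number :: "nat list \<Rightarrow> nat" where
  "seq_clique_number D =
     Max {clique_number W F | (W :: nat set) F. simple_graph W F \<and> degree_sequence W F = D}"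

definition proper_coloring :: "'a set \<Rightarrow> 'a set set \<Rightarrow> ('a \<Rightarrow> nat) \<Rightarrow> nat \<Rightarrow> bool" where
  "proper_coloring V E c k \<longleftrightarrow>
     (\<forall>v\<in>V. c v < k) \<and> (\<forall>u\<in>V. \<forall>v\<in>V. {u, v} \<in> E \<longrightarrow> c u \<noteq> c v)"

definition chromatic_number :: "'a set \<Rightarrow> 'a set set \<Rightarrow> nat" where
  "chromatic_number V E = (LEAST k. \<exists>c. proper_coloring V E c k)"

end

theory Submission
  imports Defs
begin

text \<open>
  It suffices to treat a vertex-critical induced subgraph with the same chromatic number, since a
  realization of the degrees of an induced subgraph can be substituted for it. By Gallai's theorem
  such a graph is the join of a clique \<open>U\<close> and a critical graph on a set \<open>W\<close> that is itself a
  join of critical graphs with \<open>\<chi> \<ge> 3\<close> colours and at least \<open>2 \<chi> - 1\<close> vertices each; hence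
  \<open>5 \<chi>(W) \<le> 3 |W|\<close>. Put \<open>m = min (\<chi>(W)) \<lfloor>|W| / 2\<rfloor>\<close>. On \<open>W\<close> all degrees are at least
  \<open>m - 1\<close> and \<open>|W| \<ge> 2 m\<close>, and under these two conditions some graph with the same degrees
  contains a clique on \<open>m\<close> vertices of largest degree. Together with \<open>U\<close> this gives a clique of
  order \<open>|U| + m \<ge> (5 \<chi> - 3) / 6\<close>.

  The realization is found in the complement, where the \<open>m\<close> vertices must become independent:
  a degree-constrained relation exists by a barrier argument for bipartite graphs, and it is made
  symmetric by alternating along directed closed trails of its asymmetric part. Odd trails occur
  in pairs by parity, and two of them are repaired by switching one pair joining them.
\<close>

section \<open>Degree-constrained subgraphs of bipartite graphs\<close>

definition outdeg :: "('a \<times> 'b) set \<Rightarrow> 'a \<Rightarrow> nat" where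
  "outdeg R a = card {b. (a, b) \<in> R}"

definition indeg :: "('a \<times> 'b) set \<Rightarrow> 'b \<Rightarrow> nat" where
  "indeg R b = card {a. (a, b) \<in> R}"

lemma finite_out: "finite R \<Longrightarrow> finite {b. (a, b) \<in> R}"
  by (rule finite_subset[of _ "snd ` R"]) force+

lemma finite_in: "finite R \<Longrightarrow> finite {a. (a, b) \<in> R}"
  by (rule finite_subset[of _ "fst ` R"]) force+

lemma outdeg_empty [simp]: "outdeg {} x = 0"
  by (simp add: outdeg_def)

lemma indeg_empty [simp]: "indeg {} x = 0"
  by (simp add: indeg_def)

lemma indeg_converse [simp]: "indeg (R\<inverse>) x = outdeg R x"
  by (simp add: outdeg_def indeg_def)

lemma outdeg_converse [simp]: "outdeg (R\<inverse>) x = indeg R x"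
  by (simp add: outdeg_def indeg_def)

lemma outdeg_Un:
  assumes "finite A" "finite B" "A \<inter> B = {}"
  shows "outdeg (A \<union> B) x = outdeg A x + outdeg B x"
proof -
  have "{b. (x, b) \<in> A \<union> B} = {b. (x, b) \<in> A} \<union> {b. (x, b) \<in> B}" by auto
  then show ?thesis unfolding outdeg_def
    using assms by (simp add: card_Un_disjoint finite_out disjoint_iff)
qed

lemma indeg_Un:
  assumes "finite A" "finite B" "A \<inter> B = {}"
  shows "indeg (A \<union> B) x = indeg A x + indeg B x"
proof -
  have "A\<inverse> \<inter> B\<inverse> = {}" using assms(3) by auto
  then show ?thesis using outdeg_Un[of "A\<inverse>" "B\<inverse>" x] assms by (simp flip: converse_Un)
qed

lemma outdeg_insert:
  assumes "finite R" "(a, b) \<notin> R"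
  shows "outdeg (insert (a, b) R) x = outdeg R x + (if x = a then 1 else 0)"
proof -
  have "outdeg {(a, b)} x = (if x = a then 1 else 0)" by (simp add: outdeg_def)
  then show ?thesis using outdeg_Un[of R "{(a, b)}" x] assms by simp
qed

lemma indeg_insert:
  assumes "finite R" "(a, b) \<notin> R"
  shows "indeg (insert (a, b) R) x = indeg R x + (if x = b then 1 else 0)"
proof -
  have "indeg {(a, b)} x = (if x = b then 1 else 0)" by (simp add: indeg_def)
  then show ?thesis using indeg_Un[of R "{(a, b)}" x] assms by simp
qed

lemma outdeg_Diff:
  assumes "finite R" "C \<subseteq> R"
  shows "outdeg (R - C) x + outdeg C x = outdeg R x"
proof -
  have "(R - C) \<inter> C = {}" "(R - C) \<union> C = R" using assms(2) by auto
  then show ?thesis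
    using outdeg_Un[of "R - C" C x] assms(1) finite_subset[OF assms(2,1)] by simp
qed

lemma indeg_Diff:
  assumes "finite R" "C \<subseteq> R"
  shows "indeg (R - C) x + indeg C x = indeg R x"
proof -
  have "(R - C) \<inter> C = {}" "(R - C) \<union> C = R" using assms(2) by auto
  then show ?thesis
    using indeg_Un[of "R - C" C x] assms(1) finite_subset[OF assms(2,1)] by simp
qed

lemma outdeg_remove:
  assumes "finite R" "(a, b) \<in> R"
  shows "outdeg (R - {(a, b)}) x + (if x = a then 1 else 0) = outdeg R x"
  using outdeg_insert[of "R - {(a, b)}" a b x] assms by (simp add: insert_absorb)

lemma indeg_remove:
  assumes "finite R" "(a, b) \<in> R"
  shows "indeg (R - {(a, b)}) x + (if x = b then 1 else 0) = indeg R x"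
  using indeg_insert[of "R - {(a, b)}" a b x] assms by (simp add: insert_absorb)

lemma card_eq_sum_outdeg:
  assumes "finite A" "finite R" "fst ` R \<subseteq> A"
  shows "card R = (\<Sum>a\<in>A. outdeg R a)"
proof -
  have "R = Sigma A (\<lambda>a. {b. (a, b) \<in> R})" using assms(3) by force
  then have "card R = card (Sigma A (\<lambda>a. {b. (a, b) \<in> R}))" by simp
  also have "\<dots> = (\<Sum>a\<in>A. outdeg R a)" unfolding outdeg_def
    using assms by (intro card_SigmaI) (auto simp: finite_out)
  finally show ?thesis .
qed

lemma card_eq_sum_indeg:
  assumes "finite B" "finite R" "snd ` R \<subseteq> B"
  shows "card R = (\<Sum>b\<in>B. indeg R b)"
proof -
  have "card (R\<inverse>) = (\<Sum>b\<in>B. outdeg (R\<inverse>) b)"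
    using assms by (intro card_eq_sum_outdeg) auto
  then show ?thesis by simp
qed

section \<open>Augmenting walks and the barrier of a largest feasible relation\<close>

definition feasible ::
    "('a \<times> 'b) set \<Rightarrow> ('a \<Rightarrow> nat) \<Rightarrow> ('b \<Rightarrow> nat) \<Rightarrow> ('a \<times> 'b) set \<Rightarrow> bool" where
  "feasible L r c R \<longleftrightarrow> R \<subseteq> L \<and> (\<forall>a. outdeg R a \<le> r a) \<and> (\<forall>b. indeg R b \<le> c b)"

text \<open>A walk \<open>p 0, q 0, p 1, ..., q n\<close> that goes out along pairs of
  \<open>L - R\<close> and returns along pairs of \<open>R\<close>. Vertices may repeat, so walks
  can be extended freely; repetitions are removed only when a walk is used.\<close>

definition augmenting ::
    "('a \<times> 'b) set \<Rightarrow> ('a \<Rightarrow> nat) \<Rightarrow> ('b \<Rightarrow> nat) \<Rightarrow> ('a \<times> 'b) set \<Rightarrow> nat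
      \<Rightarrow> (nat \<Rightarrow> 'a) \<Rightarrow> (nat \<Rightarrow> 'b) \<Rightarrow> bool" where
  "augmenting L r c R n p q \<longleftrightarrow>
     outdeg R (p 0) < r (p 0) \<and> indeg R (q n) < c (q n) \<and>
     (\<forall>i\<le>n. (p i, q i) \<in> L - R) \<and> (\<forall>i<n. (p (Suc i), q i) \<in> R)"

text \<open>Induction on the length. If \<open>q 0\<close> recurs at position \<open>i\<close>, the
  walk can go from \<open>p 0\<close> straight to \<open>q i\<close>. Otherwise exchanging
  \<open>(p 1, q 0)\<close> for \<open>(p 0, q 0)\<close> keeps the size and all column degrees,
  moves one unit of deficiency from \<open>p 0\<close> to \<open>p 1\<close>, and leaves a shorter
  augmenting walk.\<close>

lemma augmenting_path_enlarges:
  assumes "finite L" "feasible L r c R" "augmenting L r c R n p q"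
  shows "\<exists>R'. feasible L r c R' \<and> card R < card R'"
  using assms(2,3)
proof (induction n arbitrary: R p q rule: less_induct)
  case (less n)
  have fin: "finite R" using less.prems(1) assms(1) by (auto simp: feasible_def intro: finite_subset)
  have aug: "outdeg R (p 0) < r (p 0)" "indeg R (q n) < c (q n)"
    "\<And>i. i \<le> n \<Longrightarrow> (p i, q i) \<in> L - R" "\<And>i. i < n \<Longrightarrow> (p (Suc i), q i) \<in> R"
    using less.prems(2) by (auto simp: augmenting_def)
  have fe: "R \<subseteq> L" "\<And>a. outdeg R a \<le> r a" "\<And>b. indeg R b \<le> c b"
    using less.prems(1) by (auto simp: feasible_def)
  have new: "(p 0, q 0) \<in> L - R" using aug(3) by simp
  show ?case
  proof (cases "\<exists>i. 0 < i \<and> i \<le> n \<and> q i = q 0")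
    case True
    then obtain i where i: "0 < i" "i \<le> n" "q i = q 0" by blast
    let ?p = "\<lambda>j. if j = 0 then p 0 else p (j + i)" and ?q = "\<lambda>j. q (j + i)"
    have "augmenting L r c R (n - i) ?p ?q"
      unfolding augmenting_def
    proof (intro conjI allI impI)
      show "outdeg R (?p 0) < r (?p 0)" using aug(1) by simp
      show "indeg R (?q (n - i)) < c (?q (n - i))" using aug(2) i by simp
      show "(?p j, ?q j) \<in> L - R" if "j \<le> n - i" for j
        using aug(3)[of "j + i"] that i new by (cases j) auto
      show "(?p (Suc j), ?q j) \<in> R" if "j < n - i" for j
        using aug(4)[of "j + i"] that by simp
    qed
    moreover have "n - i < n" using i by simp
    ultimately show ?thesis using less.IH less.prems(1) by blast
  next
    case False
    show ?thesis
    proof (cases n)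
      case 0
      have "feasible L r c (insert (p 0, q 0) R)"
        unfolding feasible_def
        using fe aug(1,2) new 0 fin by (auto simp: outdeg_insert indeg_insert)
      moreover have "card (insert (p 0, q 0) R) > card R" using new fin by simp
      ultimately show ?thesis by blast
    next
      case (Suc k)
      define R' where "R' = insert (p 0, q 0) (R - {(p 1, q 0)})"
      have old: "(p 1, q 0) \<in> R" using aug(4)[of 0] Suc by simp
      have ne: "(p 0, q 0) \<notin> R - {(p 1, q 0)}" using new by auto
      have p01: "p 0 \<noteq> p 1" using new old by auto
      have out: "outdeg R' x + (if x = p 1 then 1 else 0) = outdeg R x + (if x = p 0 then 1 else 0)" for x
        using outdeg_insert[OF _ ne, of x] outdeg_remove[OF fin old, of x] fin unfolding R'_def by auto
      have inn: "indeg R' x = indeg R x" for x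
        using indeg_insert[OF _ ne, of x] indeg_remove[OF fin old, of x] fin unfolding R'_def by auto
      have out_le: "outdeg R' x \<le> r x" for x
        using out[of x] aug(1) fe(2)[of x] by (auto split: if_splits)
      have fea: "feasible L r c R'"
        using out_le inn fe new old unfolding feasible_def R'_def by auto
      have crd: "card R' = card R"
        using fin old ne unfolding R'_def
        by (metis card_Suc_Diff1 card_insert_disjoint finite_Diff)
      have same: "(x, q j) \<in> R' \<longleftrightarrow> (x, q j) \<in> R" if "0 < j" "j \<le> n" for x j
      proof -
        have "q j \<noteq> q 0" using False that by blast
        then show ?thesis unfolding R'_def by auto
      qed
      have "augmenting L r c R' k (\<lambda>j. p (Suc j)) (\<lambda>j. q (Suc j))"
        unfolding augmenting_def
      proof (intro conjI allI impI)
        show "outdeg R' (p (Suc 0)) < r (p (Suc 0))"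
          using out[of "p 1"] fe(2)[of "p 1"] p01 by simp
        show "indeg R' (q (Suc k)) < c (q (Suc k))" using aug(2) inn Suc by simp
        show "(p (Suc j), q (Suc j)) \<in> L - R'" if "j \<le> k" for j
          using aug(3)[of "Suc j"] same[of "Suc j"] that Suc by auto
        show "(p (Suc (Suc j)), q (Suc j)) \<in> R'" if "j < k" for j
          using aug(4)[of "Suc j"] same[of "Suc j"] that Suc by auto
      qed
      then show ?thesis using less.IH[of k R'] fea crd Suc by auto
    qed
  qed
qed

text \<open>Take a feasible \<open>R\<close> of largest size. \<open>T\<close> consists of the rows
  reachable by alternating walks from deficient rows, \<open>S\<close> of the columns one further
  step away. The conclusions form a certificate of maximality that is used twice: to realize
  prescribed degrees and for the matching in Gallai's theorem.\<close>

lemma degree_constrained_barrier: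
  assumes "finite A" "finite B" "L \<subseteq> A \<times> B"
  obtains R T S where "feasible L r c R" "T \<subseteq> A" "S \<subseteq> B"
    "\<And>a. a \<in> A \<Longrightarrow> a \<notin> T \<Longrightarrow> outdeg R a = r a"
    "L \<inter> T \<times> (B - S) \<subseteq> R"
    "\<And>b. b \<in> S \<Longrightarrow> indeg R b = c b"
    "\<And>a b. (a, b) \<in> R \<Longrightarrow> b \<in> S \<Longrightarrow> a \<in> T"
    "\<And>t. t \<in> T \<Longrightarrow> outdeg R t = r t \<Longrightarrow> \<exists>s\<in>S. (t, s) \<in> R"
    "T \<noteq> {} \<Longrightarrow> \<exists>t\<in>T. outdeg R t < r t"
proof -
  have finL: "finite L" using assms finite_subset by blast
  have "feasible L r c {}" by (simp add: feasible_def)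
  moreover have "card R \<le> card L" if "feasible L r c R" for R
    using that finL by (auto simp: feasible_def intro: card_mono)
  ultimately obtain R where R: "feasible L r c R"
    and mx: "\<And>R'. feasible L r c R' \<Longrightarrow> card R' \<le> card R"
    using ex_has_greatest_nat[of "feasible L r c" "{}" card "Suc (card L)"] less_Suc_eq_le by blast
  define U where "U = {a \<in> A. outdeg R a < r a}"
  define T where "T = {a. \<exists>n p q. p 0 \<in> U \<and> p n = a \<and> (\<forall>i<n. (p i, q i) \<in> L - R \<and> (p (Suc i), q i) \<in> R)}"
  define S where "S = {b. \<exists>a\<in>T. (a, b) \<in> L - R}"
  have RL: "R \<subseteq> L" using R by (simp add: feasible_def)
  have TA: "T \<subseteq> A"
  proof
    fix a assume "a \<in> T"
    then obtain n p q where n: "p 0 \<in> U" "p n = a" "\<forall>i<n. (p i, q i) \<in> L - R \<and> (p (Suc i), q i) \<in> R"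
      unfolding T_def by blast
    show "a \<in> A"
    proof (cases n)
      case 0 then show ?thesis using n U_def by auto
    next
      case (Suc k) then show ?thesis using n RL assms(3) by (metis SigmaD1 lessI subsetD)
    qed
  qed
  have UT: "a \<in> T" if "a \<in> U" for a
    unfolding T_def using that by (auto intro!: exI[of _ "0::nat"] exI[of _ "\<lambda>_. a"])
  have step: "a' \<in> T" if "a \<in> T" "(a, b) \<in> L - R" "(a', b) \<in> R" for a a' b
  proof -
    obtain n p q where n: "p 0 \<in> U" "p n = a" "\<forall>i<n. (p i, q i) \<in> L - R \<and> (p (Suc i), q i) \<in> R"
      using \<open>a \<in> T\<close> unfolding T_def by blast
    let ?p = "p(Suc n := a')" and ?q = "q(n := b)"
    have "?p 0 \<in> U \<and> ?p (Suc n) = a' \<and> (\<forall>i<Suc n. (?p i, ?q i) \<in> L - R \<and> (?p (Suc i), ?q i) \<in> R)"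
      using n that by (auto simp: less_Suc_eq)
    then show ?thesis unfolding T_def by blast
  qed
  \<comment> \<open>If a column of \<open>S\<close> were not full, the walk reaching it would be
    augmenting, against the choice of \<open>R\<close>.\<close>
  have sat: "indeg R b = c b" if "b \<in> S" for b
  proof (rule ccontr)
    assume "indeg R b \<noteq> c b"
    then have lt: "indeg R b < c b" using R by (auto simp: feasible_def order_less_le)
    obtain a where a: "a \<in> T" "(a, b) \<in> L - R" using \<open>b \<in> S\<close> S_def by blast
    obtain n p q where n: "p 0 \<in> U" "p n = a" "\<forall>i<n. (p i, q i) \<in> L - R \<and> (p (Suc i), q i) \<in> R"
      using \<open>a \<in> T\<close> unfolding T_def by blast
    have "augmenting L r c R n p (q(n := b))"
      unfolding augmenting_def using n a lt U_def by (auto simp: le_less)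
    from augmenting_path_enlarges[OF finL R this] mx show False by (meson leD)
  qed
  \<comment> \<open>A full row is not a starting point, so its walk has a last step, and that step
    comes back from a column of \<open>S\<close>.\<close>
  have ret: "\<exists>s\<in>S. (t, s) \<in> R" if "t \<in> T" "outdeg R t = r t" for t
  proof -
    obtain n p q where n: "p 0 \<in> U" "p n = t" "\<forall>i<n. (p i, q i) \<in> L - R \<and> (p (Suc i), q i) \<in> R"
      using \<open>t \<in> T\<close> unfolding T_def by blast
    have "n \<noteq> 0" using n that U_def by (metis (no_types, lifting) mem_Collect_eq order_less_irrefl)
    then obtain k where k: "n = Suc k" using not0_implies_Suc by blast
    have "p k \<in> T" unfolding T_def using n k by (auto intro!: exI[of _ k] exI[of _ p] exI[of _ q])
    then have "q k \<in> S" unfolding S_def using n k by auto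
    then show ?thesis using n k by auto
  qed
  have "U \<noteq> {}" if "T \<noteq> {}" using that unfolding T_def by blast
  then have unsat: "\<exists>t\<in>T. outdeg R t < r t" if "T \<noteq> {}"
    using that UT unfolding U_def by blast
  show thesis
  proof (rule that[OF R TA _ _ _ sat _ ret unsat])
    show "S \<subseteq> B" using S_def assms(3) by auto
    show "outdeg R a = r a" if "a \<in> A" "a \<notin> T" for a
      using that UT[of a] R unfolding U_def feasible_def by (force simp: order_less_le)
    show "L \<inter> T \<times> (B - S) \<subseteq> R" unfolding S_def by auto
    show "a \<in> T" if "(a, b) \<in> R" "b \<in> S" for a b
      using that step unfolding S_def by blast
  qed
qed

section \<open>A relation without pairs inside the low-degree vertices\<close>

text \<open>\<open>cond\<close> is the cut condition. For the barrier \<open>T\<close>,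
  \<open>S\<close>, the pairs of \<open>R\<close> into \<open>S\<close> and all pairs of
  \<open>L\<close> from \<open>T\<close> to \<open>V - S\<close> lie in \<open>R\<close> and start
  in \<open>T\<close>. By \<open>cond\<close> they are numerous enough to fill every row of
  \<open>T\<close>, and the rows outside \<open>T\<close> are full already.\<close>

lemma exists_relation_with_degrees:
  fixes r c :: "'a \<Rightarrow> nat"
  assumes "finite V" "L \<subseteq> V \<times> V" "sum r V = sum c V"
    and cond: "\<And>T S. T \<subseteq> V \<Longrightarrow> S \<subseteq> V \<Longrightarrow> sum r T \<le> sum c S + card (L \<inter> T \<times> (V - S))"
  obtains R where "R \<subseteq> L" "\<And>v. v \<in> V \<Longrightarrow> outdeg R v = r v" "\<And>v. v \<in> V \<Longrightarrow> indeg R v = c v"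
proof -
  obtain R T S where R: "feasible L r c R" "T \<subseteq> V" "S \<subseteq> V"
    "\<And>a. a \<in> V \<Longrightarrow> a \<notin> T \<Longrightarrow> outdeg R a = r a"
    "L \<inter> T \<times> (V - S) \<subseteq> R"
    "\<And>b. b \<in> S \<Longrightarrow> indeg R b = c b"
    "\<And>a b. (a, b) \<in> R \<Longrightarrow> b \<in> S \<Longrightarrow> a \<in> T"
    "\<And>t. t \<in> T \<Longrightarrow> outdeg R t = r t \<Longrightarrow> \<exists>s\<in>S. (t, s) \<in> R"
    "T \<noteq> {} \<Longrightarrow> \<exists>t\<in>T. outdeg R t < r t"
    by (rule degree_constrained_barrier[OF assms(1,1,2), where r = r and c = c]) (rule that)
  have RL: "R \<subseteq> L" "\<And>a. outdeg R a \<le> r a" "\<And>b. indeg R b \<le> c b"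
    using R(1) by (auto simp: feasible_def)
  have fin: "finite R" "finite T" "finite S"
    using RL(1) R(2,3) assms(1,2) by (meson finite_SigmaI finite_subset)+
  define X where "X = R \<inter> UNIV \<times> S"
  define Y where "Y = L \<inter> T \<times> (V - S)"
  have XY: "X \<subseteq> R" "Y \<subseteq> R" "X \<inter> Y = {}" using R(5) by (auto simp: X_def Y_def)
  have finXY: "finite X" "finite Y" using XY fin finite_subset by blast+
  have cX: "card X = sum c S"
  proof -
    have "card X = (\<Sum>b\<in>S. indeg X b)"
      using finXY fin by (intro card_eq_sum_indeg) (auto simp: X_def)
    also have "\<dots> = (\<Sum>b\<in>S. indeg R b)"
      by (intro sum.cong) (auto simp: X_def indeg_def)
    finally show ?thesis using R(6) by simp
  qed
  have XYT: "fst ` (X \<union> Y) \<subseteq> T" using R(7) by (auto simp: X_def Y_def)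
  have "sum r T \<le> card X + card Y" using cond[OF R(2,3)] cX Y_def by simp
  also have "\<dots> = card (X \<union> Y)" using XY finXY by (simp add: card_Un_disjoint)
  also have "\<dots> = (\<Sum>a\<in>T. outdeg (X \<union> Y) a)"
    using finXY fin XYT by (intro card_eq_sum_outdeg) auto
  also have "\<dots> \<le> (\<Sum>a\<in>T. outdeg R a)"
    unfolding outdeg_def using XY fin by (intro sum_mono card_mono) (auto simp: finite_out)
  finally have le: "sum r T \<le> (\<Sum>a\<in>T. outdeg R a)" .
  have "outdeg R a = r a" if "a \<in> T" for a
  proof (rule ccontr)
    assume "outdeg R a \<noteq> r a"
    then have "outdeg R a < r a" using RL(2)[of a] by simp
    then have "(\<Sum>a\<in>T. outdeg R a) < sum r T"
      using fin(2) that RL(2) by (intro sum_strict_mono_ex1) auto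
    then show False using le by simp
  qed
  then have out: "outdeg R a = r a" if "a \<in> V" for a using R(4) that by blast
  \<comment> \<open>Rows and columns have the same prescribed total, so full rows force full
    columns.\<close>
  have "(\<Sum>b\<in>V. indeg R b) = card R"
    using card_eq_sum_indeg[of V R] fin(1) assms(1,2) RL(1) by force
  also have "\<dots> = (\<Sum>a\<in>V. outdeg R a)"
    using card_eq_sum_outdeg[of V R] fin(1) assms(1,2) RL(1) by force
  also have "\<dots> = sum c V" using out assms(3) by simp
  finally have eq: "(\<Sum>b\<in>V. indeg R b) = sum c V" .
  have "indeg R b = c b" if "b \<in> V" for b
  proof (rule ccontr)
    assume "indeg R b \<noteq> c b"
    then have "indeg R b < c b" using RL(3)[of b] by simp
    then have "(\<Sum>b\<in>V. indeg R b) < sum c V"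
      using assms(1) that RL(3) by (intro sum_strict_mono_ex1) auto
    then show False using eq by simp
  qed
  then show thesis using that RL(1) out by blast
qed

section \<open>The cut condition when pairs inside a low-degree set are forbidden\<close>

definition pairs_avoiding :: "'a set \<Rightarrow> 'a set \<Rightarrow> ('a \<times> 'a) set" where
  "pairs_avoiding V K = {(a, b). a \<in> V \<and> b \<in> V \<and> a \<noteq> b \<and> \<not> (a \<in> K \<and> b \<in> K)}"

text \<open>With \<open>W = V - K\<close>, the letters stand for \<open>m = |K|\<close>,
  \<open>w = |W|\<close>, \<open>t = |T \<inter> K|\<close>, \<open>q = |T \<inter> W|\<close>,
  \<open>s = |S \<inter> K|\<close>, \<open>a = |S \<inter> W|\<close>, and \<open>e\<close> for the
  largest degree on \<open>T \<inter> K\<close>. Right minus left is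
  \<open>(a - t) * e + t * (w - a) + q * (m - s - a - 1)\<close>. If \<open>a \<ge> t\<close>, this
  is at least \<open>q * (m - s - 1)\<close> because \<open>q \<le> w - a \<le> e\<close>; otherwise
  it is at least \<open>a * (w - t) + q * (m - s - a - 1)\<close> because
  \<open>e \<le> w\<close>.\<close>

lemma barrier_arith:
  fixes m w t s a q e :: int
  assumes "t \<ge> 1" "s \<ge> 0" "a \<ge> 0" "q \<ge> 0" "t + s \<le> m" "a + q \<le> w" "m \<le> w" "e \<le> w" "w - a \<le> e"
  shows "t * e + q * w \<le> a * e + t * (w - a) + q * (m + w - s - a - 1)"
proof (cases "a \<ge> t")
  case True
  have "(a - t) * e \<ge> (a - t) * q" using True assms by (intro mult_left_mono) auto
  moreover have "t * (w - a) \<ge> t * q" using assms by (intro mult_left_mono) auto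
  moreover have "q * (m - s - 1) \<ge> 0" using assms by simp
  ultimately show ?thesis by (simp add: algebra_simps)
next
  case False
  have "(t - a) * e \<le> (t - a) * w" using False assms by (intro mult_left_mono) auto
  moreover have "a * (w - t) \<ge> 0" using assms by simp
  moreover have "q * (m - s - a - 1) \<ge> 0" using assms False by simp
  ultimately show ?thesis by (simp add: algebra_simps)
qed

text \<open>Only the rows in \<open>K\<close> lose pairs. If their degrees are at most
  \<open>|W - S|\<close>, the pairs left to them suffice and \<open>graphic\<close> takes care of
  the other rows. Otherwise the largest degree \<open>e\<close> among them is at least
  \<open>|W - S|\<close>, and by \<open>low\<close> every column of \<open>S\<close> in
  \<open>W\<close> has degree at least \<open>e\<close>; bounding the degrees by \<open>e\<close>
  and \<open>|W|\<close> leaves an inequality between cardinalities.\<close>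

lemma barrier_bound_disjoint:
  fixes d :: "'a \<Rightarrow> nat"
  assumes V: "finite V" "K \<subseteq> V" "2 * card K \<le> card V"
    and dmax: "\<And>v. v \<in> V \<Longrightarrow> d v \<le> card (V - K)"
    and low: "\<And>u w. u \<in> K \<Longrightarrow> w \<in> V - K \<Longrightarrow> d u \<le> d w"
    and graphic: "\<And>T S. T \<subseteq> V \<Longrightarrow> S \<subseteq> V \<Longrightarrow>
      sum d T \<le> sum d S + card (pairs_avoiding V {} \<inter> T \<times> (V - S))"
    and TS: "T \<subseteq> V" "S \<subseteq> V" "T \<inter> S = {}"
  shows "sum d T \<le> sum d S + card (pairs_avoiding V K \<inter> T \<times> (V - S))"
proof -
  define W where "W = V - K"
  define TK where "TK = T \<inter> K"
  define TW where "TW = T \<inter> W"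
  define SK where "SK = S \<inter> K"
  define SW where "SW = S \<inter> W"
  note defs = W_def TK_def TW_def SK_def SW_def
  have fin: "finite K" "finite W" "finite TK" "finite TW" "finite SK" "finite SW" "finite T" "finite S"
    using V TS finite_subset unfolding defs by (blast intro: finite_subset)+
  have cells: "pairs_avoiding V K \<inter> T \<times> (V - S)
      = TK \<times> (W - SW) \<union> (SIGMA t:TW. V - S - {t})"
    using V(2) TS unfolding defs pairs_avoiding_def by auto
  have cellsW: "pairs_avoiding V {} \<inter> TW \<times> (V - S) = (SIGMA t:TW. V - S - {t})"
    using V(2) TS unfolding defs pairs_avoiding_def by auto
  have disj: "TK \<times> (W - SW) \<inter> (SIGMA t:TW. V - S - {t}) = {}" unfolding defs by auto
  have cc: "card (pairs_avoiding V K \<inter> T \<times> (V - S))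
      = card TK * card (W - SW) + card (SIGMA t:TW. V - S - {t})"
    unfolding cells using disj fin V(1) by (subst card_Un_disjoint) (auto simp: card_cartesian_product)
  have sT: "sum d T = sum d TK + sum d TW"
  proof -
    have "TK \<inter> TW = {}" "T = TK \<union> TW" using TS V(2) unfolding defs by auto
    then show ?thesis using fin by (simp add: sum.union_disjoint)
  qed
  have sS: "sum d S = sum d SK + sum d SW"
  proof -
    have "SK \<inter> SW = {}" "S = SK \<union> SW" using TS V(2) unfolding defs by auto
    then show ?thesis using fin by (simp add: sum.union_disjoint)
  qed
  show ?thesis
  proof (cases "\<forall>t\<in>TK. d t \<le> card (W - SW)")
    case True
    then have "sum d TK \<le> card TK * card (W - SW)" using sum_bounded_above[of TK d] by simp
    moreover have "sum d TW \<le> sum d S + card (SIGMA t:TW. V - S - {t})"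
      using graphic[of TW S] TS cellsW unfolding TW_def by auto
    ultimately show ?thesis using cc sT by linarith
  next
    case False
    then have ne: "TK \<noteq> {}" by auto
    define e where "e = Max (d ` TK)"
    have eub: "d t \<le> e" if "t \<in> TK" for t unfolding e_def using that fin by simp
    have "e \<in> d ` TK" unfolding e_def using ne fin by simp
    then obtain t0 where t0: "t0 \<in> TK" "e = d t0" by blast
    have ele: "e \<le> card W" using t0 dmax[of t0] V(2) unfolding defs by auto
    have ege: "card (W - SW) \<le> e" using False eub by (meson le_trans nat_le_linear)
    have b1: "sum d TK \<le> card TK * e" using sum_bounded_above[of TK d e] eub by simp
    have b2: "card SW * e \<le> sum d SW"
      using sum_bounded_below[of SW e d] low t0 unfolding defs by auto
    have b3: "sum d TW \<le> card TW * card W"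
      using sum_bounded_above[of TW d "card W"] dmax unfolding defs by auto
    have c1: "card TK + card SK \<le> card K"
    proof -
      have "TK \<inter> SK = {}" "TK \<union> SK \<subseteq> K" using TS unfolding defs by auto
      then show ?thesis using card_mono[of K "TK \<union> SK"] card_Un_disjoint[of TK SK] fin by simp
    qed
    have c2: "card SW + card TW \<le> card W"
    proof -
      have "SW \<inter> TW = {}" "SW \<union> TW \<subseteq> W" using TS unfolding defs by auto
      then show ?thesis using card_mono[of W "SW \<union> TW"] card_Un_disjoint[of SW TW] fin by simp
    qed
    have c3: "card V = card K + card W"
      using V fin unfolding W_def by (metis card_Diff_subset card_mono le_add_diff_inverse)
    have c4: "card (W - SW) = card W - card SW"
      using fin unfolding defs by (subst card_Diff_subset) auto
    have cS: "card S = card SK + card SW"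
    proof -
      have "SK \<inter> SW = {}" "SK \<union> SW = S" using TS V(2) unfolding defs by auto
      then show ?thesis using card_Un_disjoint[of SK SW] fin by simp
    qed
    \<comment> \<open>As \<open>T\<close> and \<open>S\<close> are disjoint, \<open>t\<close> itself
      lies in \<open>V - S\<close>, so excluding the diagonal costs the row exactly one
      pair.\<close>
    have c5: "card (V - S - {t}) = card V - card S - 1" if "t \<in> TW" for t
    proof -
      have "t \<in> V - S" using that TS unfolding defs by auto
      then show ?thesis using TS(2) fin by (simp add: card_Diff_subset)
    qed
    have cSig: "card (SIGMA t:TW. V - S - {t}) = card TW * (card V - card S - 1)"
      using fin V(1) c5 by (subst card_SigmaI) auto
    have SV: "card S + card TW \<le> card V"
    proof -
      have "S \<inter> TW = {}" "S \<union> TW \<subseteq> V" using TS unfolding defs by auto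
      then show ?thesis using card_mono[of V "S \<union> TW"] card_Un_disjoint[of S TW] fin V(1) by simp
    qed
    \<comment> \<open>No truncation occurs in the subtraction: an element of \<open>TW\<close> lies
      in \<open>V - S\<close>, and if there is none both sides vanish.\<close>
    have prod: "int (card TW * (card V - card S - 1))
        = int (card TW) * (int (card K) + int (card W) - int (card SK) - int (card SW) - 1)"
    proof (cases "card TW = 0")
      case False
      then have "card S + 1 \<le> card V" using SV by simp
      then show ?thesis using c3 cS by (simp add: of_nat_diff)
    qed simp
    have "int (card TK) * int e + int (card TW) * int (card W)
        \<le> int (card SW) * int e + int (card TK) * (int (card W) - int (card SW))
          + int (card TW) * (int (card K) + int (card W) - int (card SK) - int (card SW) - 1)"
      using ne fin c1 c2 V(3) c3 ele ege c4
      by (intro barrier_arith) (auto simp: Suc_le_eq card_gt_0_iff)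
    also have "int (card TK) * (int (card W) - int (card SW)) = int (card TK * card (W - SW))"
      using c4 c2 by (simp add: of_nat_diff)
    finally have "int (card TK * e + card TW * card W)
        \<le> int (card SW * e + card TK * card (W - SW) + card TW * (card V - card S - 1))"
      using prod by (simp only: of_nat_add of_nat_mult)
    then have "card TK * e + card TW * card W
        \<le> card SW * e + card TK * card (W - SW) + card TW * (card V - card S - 1)"
      by (simp only: of_nat_le_iff)
    then show ?thesis using b1 b2 b3 sT sS cc cSig by linarith
  qed
qed

text \<open>The common part \<open>I\<close> of \<open>T\<close> and \<open>S\<close> contributes
  equally to both sums, so the disjoint case applies to \<open>T - S\<close> and
  \<open>S - T\<close>. The extra pairs from \<open>T - S\<close> to \<open>I\<close> become, after
  transposition, pairs from \<open>I\<close> to \<open>T - S\<close>, which are counted in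
  \<open>T \<times> (V - S)\<close>.\<close>

lemma barrier_bound:
  fixes d :: "'a \<Rightarrow> nat"
  assumes V: "finite V" "K \<subseteq> V" "2 * card K \<le> card V"
    and dmax: "\<And>v. v \<in> V \<Longrightarrow> d v \<le> card (V - K)"
    and low: "\<And>u w. u \<in> K \<Longrightarrow> w \<in> V - K \<Longrightarrow> d u \<le> d w"
    and graphic: "\<And>T S. T \<subseteq> V \<Longrightarrow> S \<subseteq> V \<Longrightarrow>
      sum d T \<le> sum d S + card (pairs_avoiding V {} \<inter> T \<times> (V - S))"
    and TS: "T \<subseteq> V" "S \<subseteq> V"
  shows "sum d T \<le> sum d S + card (pairs_avoiding V K \<inter> T \<times> (V - S))"
proof -
  let ?L = "pairs_avoiding V K"
  define I where "I = T \<inter> S"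
  define P where "P = T - S"
  have fin: "finite T" "finite S" using TS V(1) finite_subset by blast+
  have finL: "finite (?L \<inter> A)" for A
    by (rule finite_subset[of _ "V \<times> V"]) (use V(1) in \<open>auto simp: pairs_avoiding_def\<close>)
  have "sum d P \<le> sum d (S - T) + card (?L \<inter> P \<times> (V - (S - T)))"
    using barrier_bound_disjoint[OF V dmax low graphic, of P "S - T"] TS unfolding P_def by auto
  moreover have "sum d T = sum d P + sum d I"
    using fin unfolding P_def I_def by (metis add.commute sum.Int_Diff)
  moreover have "sum d S = sum d (S - T) + sum d I"
    using fin unfolding I_def by (metis add.commute inf_commute sum.Int_Diff)
  moreover have "card (?L \<inter> P \<times> (V - (S - T))) \<le> card (?L \<inter> T \<times> (V - S))"
  proof -
    have 1: "?L \<inter> P \<times> (V - (S - T)) = (?L \<inter> P \<times> (V - S)) \<union> (?L \<inter> I \<times> P)\<inverse>"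
      using TS unfolding I_def P_def pairs_avoiding_def by auto
    have "card (?L \<inter> P \<times> (V - (S - T))) \<le> card (?L \<inter> P \<times> (V - S)) + card ((?L \<inter> I \<times> P)\<inverse>)"
      unfolding 1 by (rule card_Un_le)
    also have "\<dots> = card (?L \<inter> P \<times> (V - S)) + card (?L \<inter> I \<times> P)" by simp
    also have "\<dots> = card ((?L \<inter> P \<times> (V - S)) \<union> (?L \<inter> I \<times> P))"
      by (rule card_Un_disjoint[symmetric]) (auto simp: finL I_def P_def)
    also have "\<dots> \<le> card (?L \<inter> T \<times> (V - S))"
      using finL TS by (intro card_mono) (auto simp: I_def P_def)
    finally show ?thesis .
  qed
  ultimately show ?thesis by linarith
qed

section \<open>Symmetrization\<close>

text \<open>
  Arcs in \<open>C1\<close> are to be made symmetric by adding the reverse arc, arcs in \<open>C0\<close> by deletion; the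
  shifts are the resulting changes of out- and in-degrees. Colouring a directed closed trail
  alternately preserves all degrees if the trail is even, and only the degrees at its base point
  are off by one if it is odd.
\<close>

definition row_shift :: "('a \<times> 'a) set \<Rightarrow> ('a \<times> 'a) set \<Rightarrow> 'a \<Rightarrow> int" where
  "row_shift C1 C0 x = int (indeg C1 x) - int (outdeg C0 x)"

definition col_shift :: "('a \<times> 'a) set \<Rightarrow> ('a \<times> 'a) set \<Rightarrow> 'a \<Rightarrow> int" where
  "col_shift C1 C0 x = int (outdeg C1 x) - int (indeg C0 x)"

definition has_shift :: "('a \<times> 'a) set \<Rightarrow> ('a \<times> 'a) set \<Rightarrow> ('a \<Rightarrow> int) \<Rightarrow> bool" where
  "has_shift C1 C0 f \<longleftrightarrow> (\<forall>x. row_shift C1 C0 x = f x \<and> col_shift C1 C0 x = f x)"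

section \<open>Combining and recolouring shifts\<close>

lemma has_shift_swap: "has_shift C1 C0 f \<Longrightarrow> has_shift C0 C1 (\<lambda>x. - f x)"
  unfolding has_shift_def row_shift_def col_shift_def by (metis minus_diff_eq)

lemma has_shift_Un:
  assumes "has_shift C1 C0 f" "has_shift B1 B0 g" "finite (C1 \<union> C0 \<union> B1 \<union> B0)"
    "(C1 \<union> C0) \<inter> (B1 \<union> B0) = {}"
  shows "has_shift (C1 \<union> B1) (C0 \<union> B0) (\<lambda>x. f x + g x)"
proof -
  have "C1 \<inter> B1 = {}" "C0 \<inter> B0 = {}" using assms(4) by auto
  then have un: "indeg (C1 \<union> B1) x = indeg C1 x + indeg B1 x"
      "outdeg (C1 \<union> B1) x = outdeg C1 x + outdeg B1 x"
      "indeg (C0 \<union> B0) x = indeg C0 x + indeg B0 x"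
      "outdeg (C0 \<union> B0) x = outdeg C0 x + outdeg B0 x" for x
    using assms(3) by (simp_all add: outdeg_Un indeg_Un)
  show ?thesis
    unfolding has_shift_def row_shift_def col_shift_def un
    using assms(1,2)[unfolded has_shift_def row_shift_def col_shift_def] by (simp add: algebra_simps)
qed

text \<open>Deleting an arc instead of adding its reverse changes the pair by two arcs, one in each
  direction, so both shifts drop by one at both ends.\<close>

lemma has_shift_recolour:
  assumes "has_shift C1 C0 f" "(p, q) \<in> C1" "(p, q) \<notin> C0" "finite C1" "finite C0"
  shows "has_shift (C1 - {(p, q)}) (insert (p, q) C0)
    (\<lambda>x. f x - (if x = p then 1 else 0) - (if x = q then 1 else 0))"
  unfolding has_shift_def row_shift_def col_shift_def
proof (intro allI conjI)
  fix x
  note sh = assms(1)[unfolded has_shift_def row_shift_def col_shift_def, rule_format, of x]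
  show "int (indeg (C1 - {(p, q)}) x) - int (outdeg (insert (p, q) C0) x) =
         f x - (if x = p then 1 else 0) - (if x = q then 1 else 0)"
    using sh indeg_remove[OF assms(4,2), of x] outdeg_insert[OF assms(5,3), of x]
    by (auto split: if_splits)
  show "int (outdeg (C1 - {(p, q)}) x) - int (indeg (insert (p, q) C0) x) =
         f x - (if x = p then 1 else 0) - (if x = q then 1 else 0)"
    using sh outdeg_remove[OF assms(4,2), of x] indeg_insert[OF assms(5,3), of x]
    by (auto split: if_splits)
qed

lemma has_shift_balanced:
  assumes "has_shift C1 C0 f" "finite C1" "finite C0" "C1 \<inter> C0 = {}"
  shows "outdeg (C1 \<union> C0) x = indeg (C1 \<union> C0) x"
  using assms(1)[unfolded has_shift_def row_shift_def col_shift_def, rule_format, of x] assms(2-)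
  by (simp add: outdeg_Un indeg_Un)

text \<open>Start with \<open>(a, b)\<close> in \<open>C1\<close> and extend the trail with
  alternating colours, never leaving \<open>a\<close> again. By balance a trail ending at
  \<open>x\<close> other than \<open>a\<close> can always be continued, so the continuation of a
  longest one must return to \<open>a\<close>. The shifts encode the trail, and no order of its arcs
  is stored.\<close>

lemma alternating_closed_trail:
  assumes fin: "finite D" and irr: "\<And>x. (x, x) \<notin> D"
    and bal: "\<And>x. outdeg D x = indeg D x" and ab: "(a, b) \<in> D"
  obtains C1 C0 where "C1 \<union> C0 \<subseteq> D" "C1 \<inter> C0 = {}"
    "outdeg (C1 \<union> C0) a = 1" "indeg (C1 \<union> C0) a = 1"
    "has_shift C1 C0 (\<lambda>_. 0) \<or> has_shift C1 C0 (\<lambda>x. if x = a then 1 else 0)"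
proof -
  \<comment> \<open>\<open>st\<close> describes an open trail from \<open>a\<close> to
    \<open>x\<close>. The first alternative is that its last arc lies in \<open>C1\<close>, the
    second that it lies in \<open>C0\<close>.\<close>
  define st where "st = (\<lambda>(C1, C0, x).
     C1 \<union> C0 \<subseteq> D \<and> C1 \<inter> C0 = {} \<and> x \<noteq> a \<and> outdeg (C1 \<union> C0) a = 1 \<and> indeg (C1 \<union> C0) a = 0 \<and>
     ((\<forall>y. row_shift C1 C0 y = (if y = x then 1 else 0) \<and> col_shift C1 C0 y = (if y = a then 1 else 0)) \<or>
      (\<forall>y. row_shift C1 C0 y = 0 \<and>
        col_shift C1 C0 y = (if y = a then 1 else 0) - (if y = x then 1 else 0))))"
  define sz where "sz = (\<lambda>(C1 :: ('a \<times> 'a) set, C0 :: ('a \<times> 'a) set, x :: 'a). card (C1 \<union> C0))"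
  have one: "outdeg {(a, b)} y = (if y = a then 1 else 0)" "indeg {(a, b)} y = (if y = b then 1 else 0)" for y
    by (auto simp: outdeg_def indeg_def)
  have "a \<noteq> b" using irr ab by auto
  then have start: "st ({(a, b)}, {}, b)"
    unfolding st_def row_shift_def col_shift_def using ab by (auto simp: one)
  have "\<forall>z. st z \<longrightarrow> sz z < Suc (card D)"
    unfolding st_def sz_def using fin by (auto simp: less_Suc_eq_le intro!: card_mono)
  then obtain z where z: "st z" "\<And>z'. st z' \<Longrightarrow> sz z' \<le> sz z"
    using ex_has_greatest_nat[of st, OF start] by blast
  obtain C1 C0 x where zC: "z = (C1, C0, x)" by (cases z) auto
  have s: "C1 \<union> C0 \<subseteq> D" "C1 \<inter> C0 = {}" "x \<noteq> a" "outdeg (C1 \<union> C0) a = 1" "indeg (C1 \<union> C0) a = 0"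
    and ty: "(\<forall>y. row_shift C1 C0 y = (if y = x then 1 else 0) \<and> col_shift C1 C0 y = (if y = a then 1 else 0)) \<or>
      (\<forall>y. row_shift C1 C0 y = 0 \<and>
        col_shift C1 C0 y = (if y = a then 1 else 0) - (if y = x then 1 else 0))"
    using z(1) unfolding st_def zC by auto
  have finC: "finite C1" "finite C0" using s(1) fin by (auto intro: finite_subset)
  have "int (outdeg (C1 \<union> C0) x) - int (indeg (C1 \<union> C0) x) = col_shift C1 C0 x - row_shift C1 C0 x"
    using finC s(2) by (simp add: outdeg_Un indeg_Un row_shift_def col_shift_def)
  also have "\<dots> = - 1" using ty s(3) by auto
  finally have "outdeg (C1 \<union> C0) x < indeg (C1 \<union> C0) x" by simp
  also have "\<dots> \<le> indeg D x"
    unfolding indeg_def using s(1) fin by (intro card_mono) (auto simp: finite_in)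
  finally have "outdeg (C1 \<union> C0) x < outdeg D x" by (simp add: bal)
  then have "\<not> {y. (x, y) \<in> D} \<subseteq> {y. (x, y) \<in> C1 \<union> C0}"
    using card_mono[OF finite_out[of "C1 \<union> C0" x], of "{y. (x, y) \<in> D}"] finC
    unfolding outdeg_def by auto
  then obtain y where y: "(x, y) \<in> D" "(x, y) \<notin> C1" "(x, y) \<notin> C0" by auto
  \<comment> \<open>Row shift 1 at \<open>x\<close> means that the last arc is in \<open>C1\<close>;
    the new arc gets the other colour.\<close>
  define E1 E0 where "E1 = (if row_shift C1 C0 x = 1 then C1 else insert (x, y) C1)"
    and "E0 = (if row_shift C1 C0 x = 1 then insert (x, y) C0 else C0)"
  have E: "E1 \<union> E0 = insert (x, y) (C1 \<union> C0)" "E1 \<inter> E0 = {}" "E1 \<union> E0 \<subseteq> D"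
    unfolding E1_def E0_def using y s(1,2) by auto
  have out: "outdeg (E1 \<union> E0) a = 1"
    unfolding E(1) using s(3,4) y finC by (subst outdeg_insert) auto
  have inn: "indeg (E1 \<union> E0) a = (if y = a then 1 else 0)"
    unfolding E(1) using s(5) y finC by (subst indeg_insert) auto
  have ty': "(\<forall>v. row_shift E1 E0 v = (if v = y then 1 else 0) \<and> col_shift E1 E0 v = (if v = a then 1 else 0)) \<or>
      (\<forall>v. row_shift E1 E0 v = 0 \<and>
        col_shift E1 E0 v = (if v = a then 1 else 0) - (if v = y then 1 else 0))"
  proof (cases "row_shift C1 C0 x = 1")
    case True
    then have A: "row_shift C1 C0 v = (if v = x then 1 else 0)" "col_shift C1 C0 v = (if v = a then 1 else 0)" for v
      using ty by (metis zero_neq_one)+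
    have "row_shift E1 E0 v = 0 \<and> col_shift E1 E0 v = (if v = a then 1 else 0) - (if v = y then 1 else 0)" for v
      using A[of v] True finC y unfolding E1_def E0_def row_shift_def col_shift_def
      by (auto simp: outdeg_insert indeg_insert split: if_splits)
    then show ?thesis by blast
  next
    case False
    then have B: "row_shift C1 C0 v = 0" "col_shift C1 C0 v = (if v = a then 1 else 0) - (if v = x then 1 else 0)" for v
      using ty by metis+
    have "row_shift E1 E0 v = (if v = y then 1 else 0) \<and> col_shift E1 E0 v = (if v = a then 1 else 0)" for v
      using B[of v] False finC y unfolding E1_def E0_def row_shift_def col_shift_def
      by (auto simp: outdeg_insert indeg_insert split: if_splits)
    then show ?thesis by blast
  qed
  have "y = a"
  proof (rule ccontr)
    assume "y \<noteq> a"
    then have "st (E1, E0, y)" unfolding st_def using E out inn ty' by auto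
    from z(2)[OF this] have "card (insert (x, y) (C1 \<union> C0)) \<le> card (C1 \<union> C0)"
      unfolding sz_def zC using E(1) by simp
    then show False using y finC by simp
  qed
  then have "has_shift E1 E0 (\<lambda>_. 0) \<or> has_shift E1 E0 (\<lambda>x. if x = a then 1 else 0)"
    using ty' unfolding has_shift_def by auto
  then show thesis using that[OF E(3,2) out] inn \<open>y = a\<close> by simp
qed

section \<open>Making asymmetric arcs symmetric\<close>

definition flip_arcs :: "('a \<times> 'a) set \<Rightarrow> ('a \<times> 'a) set \<Rightarrow> ('a \<times> 'a) set \<Rightarrow> ('a \<times> 'a) set" where
  "flip_arcs R C1 C0 = (R \<union> C1\<inverse>) - C0"

text \<open>Arcs of \<open>R - R\<inverse>\<close> have no reverse in \<open>R\<close>, so additions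
  and deletions do not interfere, and each arc of \<open>C1\<close> or \<open>C0\<close> leaves the
  asymmetric part while no new one enters.\<close>

lemma flip_arcs:
  assumes "finite R" "C1 \<subseteq> R - R\<inverse>" "C0 \<subseteq> R - R\<inverse>" "C1 \<inter> C0 = {}"
  shows "int (outdeg (flip_arcs R C1 C0) x) = int (outdeg R x) + row_shift C1 C0 x"
    and "int (indeg (flip_arcs R C1 C0) x) = int (indeg R x) + col_shift C1 C0 x"
    and "flip_arcs R C1 C0 - (flip_arcs R C1 C0)\<inverse> = R - R\<inverse> - (C1 \<union> C0)"
proof -
  have fin: "finite C1" "finite C0" using assms by (auto intro: finite_subset)
  have dj: "R \<inter> C1\<inverse> = {}" "C0 \<subseteq> R \<union> C1\<inverse>" using assms by auto
  have "outdeg (flip_arcs R C1 C0) x + outdeg C0 x = outdeg R x + indeg C1 x"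
    unfolding flip_arcs_def using outdeg_Diff[OF _ dj(2), of x] outdeg_Un[OF assms(1) _ dj(1), of x] fin assms(1)
    by simp
  then show "int (outdeg (flip_arcs R C1 C0) x) = int (outdeg R x) + row_shift C1 C0 x"
    by (simp add: row_shift_def)
  have "indeg (flip_arcs R C1 C0) x + indeg C0 x = indeg R x + outdeg C1 x"
    unfolding flip_arcs_def using indeg_Diff[OF _ dj(2), of x] indeg_Un[OF assms(1) _ dj(1), of x] fin assms(1)
    by simp
  then show "int (indeg (flip_arcs R C1 C0) x) = int (indeg R x) + col_shift C1 C0 x"
    by (simp add: col_shift_def)
  show "flip_arcs R C1 C0 - (flip_arcs R C1 C0)\<inverse> = R - R\<inverse> - (C1 \<union> C0)"
    unfolding flip_arcs_def using assms(2-4) by auto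
qed

lemma even_card_symmetric:
  assumes "finite R" "R\<inverse> = R" "\<And>x. (x, x) \<notin> R"
  shows "even (card R)"
  using assms
proof (induction "card R" arbitrary: R rule: less_induct)
  case less
  show ?case
  proof (cases "R = {}")
    case False
    then obtain a b where ab: "(a, b) \<in> R" by auto
    then have ba: "(b, a) \<in> R" "a \<noteq> b" using less.prems by auto
    let ?R = "R - {(a, b), (b, a)}"
    have "card R = card ?R + 2"
      using ab ba less.prems(1) card_Diff_subset[of "{(a, b), (b, a)}" R] card_mono[of R "{(a, b), (b, a)}"]
      by auto
    moreover have "?R\<inverse> = ?R" using less.prems(2) by auto
    then have "even (card ?R)"
      using less.hyps[of ?R] less.prems calculation by auto
    ultimately show ?thesis by simp
  qed simp
qed

text \<open>Choose \<open>R\<close> with the fewest arcs in its asymmetric part \<open>D\<close>.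
  Flipping an even closed trail in \<open>D\<close> would reduce it, so every trail obtained is odd.
  Parity of \<open>|D|\<close> yields two disjoint odd trails with bases \<open>a\<close> and
  \<open>b\<close>; both are flipped, and the degree errors at \<open>a\<close> and \<open>b\<close>
  are repaired by adding or deleting the pair \<open>a\<close>, \<open>b\<close> in both
  directions.\<close>

theorem exists_symmetric_relation:
  assumes V: "finite V" "K \<subseteq> V"
    and R0: "R0 \<subseteq> pairs_avoiding V K" "\<And>v. outdeg R0 v = d v" "\<And>v. indeg R0 v = d v"
    and ev: "even (sum d V)"
  obtains R where "R \<subseteq> pairs_avoiding V K" "R\<inverse> = R" "\<And>v. outdeg R v = d v"
proof -
  let ?L = "pairs_avoiding V K"
  define P where "P = (\<lambda>R. R \<subseteq> ?L \<and> (\<forall>v. outdeg R v = d v \<and> indeg R v = d v))"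
  obtain R where R: "P R" and mn: "\<And>R'. P R' \<Longrightarrow> card (R - R\<inverse>) \<le> card (R' - R'\<inverse>)"
    using ex_has_least_nat[of P R0 "\<lambda>R. card (R - R\<inverse>)"] R0 unfolding P_def by blast
  have RL: "R \<subseteq> ?L" "\<And>v. outdeg R v = d v" "\<And>v. indeg R v = d v" using R P_def by auto
  have LV: "?L \<subseteq> V \<times> V" "\<And>x. (x, x) \<notin> ?L" "?L\<inverse> = ?L" unfolding pairs_avoiding_def by auto
  have finR: "finite R" using RL(1) LV(1) V(1) by (meson finite_SigmaI finite_subset)
  define D where "D = R - R\<inverse>"
  have finD: "finite D" using finR D_def by simp
  have irr: "(x, x) \<notin> D" for x using LV(2) RL(1) D_def by auto
  have bal: "outdeg D x = indeg D x" for x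
  proof -
    have "R - D = R \<inter> R\<inverse>" unfolding D_def by auto
    then have "(R - D)\<inverse> = R - D" by auto
    then have "outdeg (R - D) x = indeg (R - D) x" by (metis indeg_converse)
    then show ?thesis
      using outdeg_Diff[of R D x] indeg_Diff[of R D x] finR RL(2,3) unfolding D_def by simp
  qed
  \<comment> \<open>A nonempty part of \<open>D\<close> with zero shift could be flipped without
    changing degrees, leaving a smaller asymmetric part.\<close>
  have even_bal: False
    if "C1 \<union> C0 \<subseteq> D" "C1 \<inter> C0 = {}" "C1 \<union> C0 \<noteq> {}" "has_shift C1 C0 (\<lambda>_. 0)" for C1 C0
  proof -
    let ?R = "flip_arcs R C1 C0"
    have sub: "C1 \<subseteq> R - R\<inverse>" "C0 \<subseteq> R - R\<inverse>" using that D_def by auto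
    note fl = flip_arcs[OF finR sub that(2)]
    have "C1 \<subseteq> ?L" using sub RL(1) by auto
    then have "C1\<inverse> \<subseteq> ?L" using LV(3) by auto
    then have "?R \<subseteq> ?L" unfolding flip_arcs_def using RL(1) by auto
    moreover have "outdeg ?R v = d v" "indeg ?R v = d v" for v
      using fl(1)[of v] fl(2)[of v] that(4) RL unfolding has_shift_def by auto
    ultimately have "P ?R" unfolding P_def by auto
    moreover have "card (?R - ?R\<inverse>) < card D"
      unfolding fl(3) D_def[symmetric] using that finD by (intro psubset_card_mono) auto
    ultimately show False using mn[of ?R] unfolding D_def by simp
  qed
  have "D = {}"
  proof (rule ccontr)
    assume "D \<noteq> {}"
    then obtain p q where pq: "(p, q) \<in> D" by auto
    have pqL: "(p, q) \<in> ?L" using pq RL(1) D_def by auto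
    have ex_out: "\<exists>b. (x, b) \<in> D'" if "outdeg D' x > 0" for D' :: "('a \<times> 'a) set" and x
      using that unfolding outdeg_def by (metis Collect_empty_eq card.empty less_irrefl)
    have posout: "outdeg D' x > 0" if "(x, b) \<in> D'" "finite D'" for D' :: "('a \<times> 'a) set" and x b
      using that unfolding outdeg_def by (auto simp: card_gt_0_iff finite_out)
    have posin: "indeg D' b > 0" if "(x, b) \<in> D'" "finite D'" for D' :: "('a \<times> 'a) set" and x b
      using that unfolding indeg_def by (auto simp: card_gt_0_iff finite_in)
    \<comment> \<open>The base is taken outside \<open>K\<close>, so that the pair joining it to any
      other vertex of \<open>V\<close> is admissible. Of two ends of an arc at most one is in
      \<open>K\<close>, and by balance \<open>D\<close> also has an arc out of its head.\<close>
    obtain a a' where a: "(a, a') \<in> D" "a \<in> V" "a \<notin> K"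
    proof (cases "p \<in> K")
      case False
      then show ?thesis using that pq pqL LV(1) by auto
    next
      case True
      then have "q \<in> V" "q \<notin> K" using pqL unfolding pairs_avoiding_def by auto
      moreover obtain b where "(q, b) \<in> D" using ex_out posin[OF pq finD] bal by metis
      ultimately show ?thesis using that by blast
    qed
    have aL: "(a, x) \<in> ?L" "(x, a) \<in> ?L" if "x \<in> V" "x \<noteq> a" for x
      using a that unfolding pairs_avoiding_def by auto
    obtain C1 C0 where C: "C1 \<union> C0 \<subseteq> D" "C1 \<inter> C0 = {}" "outdeg (C1 \<union> C0) a = 1" "indeg (C1 \<union> C0) a = 1"
      "has_shift C1 C0 (\<lambda>_. 0) \<or> has_shift C1 C0 (\<lambda>x. if x = a then 1 else 0)"
      by (rule alternating_closed_trail[OF finD irr bal a(1)]) (rule that)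
    have Cne: "C1 \<union> C0 \<noteq> {}" using C(3) by (metis outdeg_empty zero_neq_one)
    have finC: "finite C1" "finite C0" using C(1) finD by (auto intro: finite_subset)
    have Csh: "has_shift C1 C0 (\<lambda>x. if x = a then 1 else 0)" using C even_bal Cne by blast
    have Ca: "outdeg C0 a = 0" "indeg C0 a = 0"
      using Csh[unfolded has_shift_def row_shift_def col_shift_def, rule_format, of a] C(3,4) finC C(2)
      by (auto simp: outdeg_Un indeg_Un)
    define D2 where "D2 = D - (C1 \<union> C0)"
    have finD2: "finite D2" and irr2: "\<And>x. (x, x) \<notin> D2" using finD irr unfolding D2_def by auto
    have bal2: "outdeg D2 x = indeg D2 x" for x
      using outdeg_Diff[OF finD C(1), of x] indeg_Diff[OF finD C(1), of x] bal[of x]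
        has_shift_balanced[OF Csh finC C(2), of x] unfolding D2_def by simp
    \<comment> \<open>A second odd trail at \<open>a\<close>, with its colours exchanged, would
      cancel the shift of the first.\<close>
    have a2: "outdeg D2 a = 0"
    proof (rule ccontr)
      assume "outdeg D2 a \<noteq> 0"
      then obtain b where ab2: "(a, b) \<in> D2" using ex_out by blast
      obtain B1 B0 where B: "B1 \<union> B0 \<subseteq> D2" "B1 \<inter> B0 = {}" "outdeg (B1 \<union> B0) a = 1" "indeg (B1 \<union> B0) a = 1"
        "has_shift B1 B0 (\<lambda>_. 0) \<or> has_shift B1 B0 (\<lambda>x. if x = a then 1 else 0)"
        by (rule alternating_closed_trail[OF finD2 irr2 bal2 ab2]) (rule that)
      have Bne: "B1 \<union> B0 \<noteq> {}" using B(3) by (metis outdeg_empty zero_neq_one)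
      have "has_shift B1 B0 (\<lambda>x. if x = a then 1 else 0)"
        using B even_bal[of B1 B0] Bne unfolding D2_def by blast
      from has_shift_Un[OF Csh has_shift_swap[OF this]]
      have "has_shift (C1 \<union> B0) (C0 \<union> B1) (\<lambda>_. 0)"
        using B(1) finD2 finC unfolding D2_def by (auto intro: finite_subset)
      then show False using even_bal[of "C1 \<union> B0" "C0 \<union> B1"] B(1,2) C(1,2) Cne unfolding D2_def by blast
    qed
    \<comment> \<open>The total shift is \<open>|C1| - |C0|\<close>, and it equals 1. Since
      \<open>|D|\<close> is even, arcs remain outside this trail.\<close>
    have cardC: "odd (card (C1 \<union> C0))"
    proof -
      have "C1 \<subseteq> V \<times> V" "C0 \<subseteq> V \<times> V" using C(1) RL(1) LV(1) unfolding D_def by auto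
      then have "int (card C1) - int (card C0) = (\<Sum>x\<in>V. row_shift C1 C0 x)"
        unfolding row_shift_def sum_subtractf
        using card_eq_sum_indeg[of V C1] card_eq_sum_outdeg[of V C0] finC V(1) by force
      also have "\<dots> = 1" using Csh a(2) V(1) unfolding has_shift_def by simp
      finally have "card C1 = card C0 + 1" by simp
      then show ?thesis using C(2) finC by (simp add: card_Un_disjoint)
    qed
    have cardD: "even (card D)"
    proof -
      have "card R = sum d V"
        using card_eq_sum_outdeg[of V R] V(1) finR RL LV(1) by fastforce
      moreover have "even (card (R \<inter> R\<inverse>))"
        using finR RL(1) LV(2) by (intro even_card_symmetric) auto
      moreover have "card R = card D + card (R \<inter> R\<inverse>)"
        using card_Int_Diff[OF finR, of "R\<inverse>"] unfolding D_def by simp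
      ultimately show ?thesis using ev by (metis even_add)
    qed
    have "D2 \<noteq> {}" using cardC cardD C(1) unfolding D2_def by (metis Diff_eq_empty_iff subset_antisym)
    then obtain b b' where b: "(b, b') \<in> D2" by auto
    obtain B1 B0 where B: "B1 \<union> B0 \<subseteq> D2" "B1 \<inter> B0 = {}" "outdeg (B1 \<union> B0) b = 1" "indeg (B1 \<union> B0) b = 1"
      "has_shift B1 B0 (\<lambda>_. 0) \<or> has_shift B1 B0 (\<lambda>x. if x = b then 1 else 0)"
      by (rule alternating_closed_trail[OF finD2 irr2 bal2 b]) (rule that)
    have Bne: "B1 \<union> B0 \<noteq> {}" using B(3) by (metis outdeg_empty zero_neq_one)
    have Bsh: "has_shift B1 B0 (\<lambda>x. if x = b then 1 else 0)"
      using B even_bal[of B1 B0] Bne unfolding D2_def by blast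
    have finB: "finite B1" "finite B0" using B(1) finD2 by (auto intro: finite_subset)
    have CB: "(C1 \<union> C0) \<inter> (B1 \<union> B0) = {}" using B(1) unfolding D2_def by auto
    have ba: "b \<noteq> a" using a2 posout[OF b finD2] by auto
    have bV: "b \<in> V" using b RL(1) LV(1) unfolding D2_def D_def by auto
    \<comment> \<open>An arc of \<open>D\<close> between \<open>a\<close> and \<open>b\<close> has
      to lie in \<open>C1\<close>. Moving it to \<open>C0\<close> turns the shift 1 at
      \<open>a\<close> into -1 at \<open>b\<close>, which cancels the shift of the trail based at
      \<open>b\<close>.\<close>
    have noarc: False if arc: "(x, y) \<in> D" and xy: "(x, y) = (a, b) \<or> (x, y) = (b, a)" for x y
    proof -
      have "(x, y) \<notin> D2" using a2 bal2[of a] posout[of x y D2] posin[of x y D2] finD2 xy by auto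
      moreover have "(x, y) \<notin> C0" using Ca posout[of x y C0] posin[of x y C0] finC xy by auto
      ultimately have xyC: "(x, y) \<in> C1" "(x, y) \<notin> C0" using arc unfolding D2_def by auto
      let ?C1 = "C1 - {(x, y)}" and ?C0 = "insert (x, y) C0"
      have "(\<lambda>v. (if v = a then 1 else 0) - (if v = x then 1 else 0) - (if v = y then 1 else 0) :: int)
          = (\<lambda>v. - (if v = b then 1 else 0))" using xy ba by auto
      then have "has_shift ?C1 ?C0 (\<lambda>v. - (if v = b then 1 else 0))"
        using has_shift_recolour[OF Csh xyC finC] by simp
      from has_shift_Un[OF this Bsh] have "has_shift (?C1 \<union> B1) (?C0 \<union> B0) (\<lambda>_. 0)"
        using finB finC CB xyC by auto
      moreover have "(?C1 \<union> B1) \<union> (?C0 \<union> B0) \<subseteq> D" "(?C1 \<union> B1) \<inter> (?C0 \<union> B0) = {}"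
        using arc C(1,2) B(1,2) CB xyC unfolding D2_def by auto
      ultimately show False using even_bal[of "?C1 \<union> B1" "?C0 \<union> B0"] by blast
    qed
    have sym_ab: "(a, b) \<in> R \<longleftrightarrow> (b, a) \<in> R" "(a, b) \<notin> D" "(b, a) \<notin> D"
      using noarc unfolding D_def by auto
    \<comment> \<open>The sign is chosen by the state of the pair \<open>a\<close>,
      \<open>b\<close>: if it is present, the flip raises the degrees at both and the pair is
      deleted; if absent, the colours are exchanged, the degrees drop and the pair is added.\<close>
    define F1 F0 where "F1 = (if (a, b) \<in> R then C1 \<union> B1 else C0 \<union> B0)"
      and "F0 = (if (a, b) \<in> R then C0 \<union> B0 else C1 \<union> B1)"
    define e :: int where "e = (if (a, b) \<in> R then 1 else - 1)"
    have sh: "has_shift F1 F0 (\<lambda>x. e * ((if x = a then 1 else 0) + (if x = b then 1 else 0)))"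
    proof -
      have 1: "has_shift (C1 \<union> B1) (C0 \<union> B0) (\<lambda>x. (if x = a then 1 else 0) + (if x = b then 1 else 0))"
        using has_shift_Un[OF Csh Bsh] finB finC CB by simp
      then show ?thesis using has_shift_swap[OF 1] unfolding F1_def F0_def e_def by simp
    qed
    have FD: "F1 \<union> F0 \<subseteq> D" "F1 \<inter> F0 = {}" "F1 \<union> F0 \<noteq> {}"
      using C(1,2) B(1,2) CB Cne unfolding F1_def F0_def D2_def by auto
    have Fs: "F1 \<subseteq> R - R\<inverse>" "F0 \<subseteq> R - R\<inverse>" using FD(1) D_def by auto
    define R1 where "R1 = flip_arcs R F1 F0"
    note fl = flip_arcs[OF finR Fs FD(2), folded R1_def]
    have R1ab: "(a, b) \<in> R1 \<longleftrightarrow> (a, b) \<in> R" "(b, a) \<in> R1 \<longleftrightarrow> (a, b) \<in> R"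
      using sym_ab FD(1) unfolding R1_def flip_arcs_def by auto
    define R2 where "R2 = (if (a, b) \<in> R then R1 - {(a, b)} - {(b, a)} else insert (a, b) (insert (b, a) R1))"
    have finR1: "finite R1" unfolding R1_def flip_arcs_def using finR FD finD
      by (meson finite_Diff finite_UnI finite_converse finite_subset le_supE)
    have degR2: "int (outdeg R2 x) = int (outdeg R1 x) - e * ((if x = a then 1 else 0) + (if x = b then 1 else 0))"
      "int (indeg R2 x) = int (indeg R1 x) - e * ((if x = a then 1 else 0) + (if x = b then 1 else 0))" for x
    proof -
      show "int (outdeg R2 x) = int (outdeg R1 x) - e * ((if x = a then 1 else 0) + (if x = b then 1 else 0))"
      proof (cases "(a, b) \<in> R")
        case True
        have "(a, b) \<in> R1" "(b, a) \<in> R1 - {(a, b)}" using R1ab True ba by auto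
        then show ?thesis unfolding R2_def e_def
          using outdeg_remove[OF finR1, of a b x] outdeg_remove[of "R1 - {(a, b)}" b a x] finR1 True ba
          by (auto split: if_splits)
      next
        case False
        have "(b, a) \<notin> R1" "(a, b) \<notin> insert (b, a) R1" using R1ab False ba by auto
        then show ?thesis unfolding R2_def e_def
          using finR1 False ba by (auto simp: outdeg_insert split: if_splits)
      qed
      show "int (indeg R2 x) = int (indeg R1 x) - e * ((if x = a then 1 else 0) + (if x = b then 1 else 0))"
      proof (cases "(a, b) \<in> R")
        case True
        have "(a, b) \<in> R1" "(b, a) \<in> R1 - {(a, b)}" using R1ab True ba by auto
        then show ?thesis unfolding R2_def e_def
          using indeg_remove[OF finR1, of a b x] indeg_remove[of "R1 - {(a, b)}" b a x] finR1 True ba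
          by (auto split: if_splits)
      next
        case False
        have "(b, a) \<notin> R1" "(a, b) \<notin> insert (b, a) R1" using R1ab False ba by auto
        then show ?thesis unfolding R2_def e_def
          using finR1 False ba by (auto simp: indeg_insert split: if_splits)
      qed
    qed
    have "outdeg R2 x = d x" "indeg R2 x = d x" for x
      using degR2[of x] fl(1)[of x] fl(2)[of x] sh[unfolded has_shift_def, rule_format, of x] RL(2,3)[of x]
      by auto
    moreover have "R2 \<subseteq> ?L"
    proof -
      have "F1 \<subseteq> ?L" using Fs RL(1) by auto
      then have "F1\<inverse> \<subseteq> ?L" using LV(3) by auto
      then have "R1 \<subseteq> ?L" unfolding R1_def flip_arcs_def using RL(1) by auto
      then show ?thesis unfolding R2_def using aL[OF bV ba] by auto
    qed
    ultimately have "P R2" unfolding P_def by auto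
    moreover have "R2 - R2\<inverse> \<subseteq> D - (F1 \<union> F0)"
      using fl(3) R1ab unfolding R2_def D_def[symmetric] by (auto split: if_splits)
    then have "card (R2 - R2\<inverse>) < card D"
      using FD finD by (intro psubset_card_mono) auto
    ultimately show False using mn[of R2] unfolding D_def by simp
  qed
  then have "R\<inverse> = R" unfolding D_def by auto
  then show thesis using that RL by blast
qed

section \<open>Realizations with a prescribed clique\<close>

lemma simple_graph_edge:
  assumes "simple_graph V E" "{v, w} \<in> E"
  shows "v \<in> V" "w \<in> V" "v \<noteq> w"
proof -
  have "{v, w} \<subseteq> V" "card {v, w} = 2"
    using assms unfolding simple_graph_def nsets_def by auto
  then show "v \<in> V" "w \<in> V" "v \<noteq> w" by auto
qed

lemma simple_graph_edgeE:
  assumes "simple_graph V E" "e \<in> E" "v \<in> e"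
  obtains w where "e = {v, w}" "w \<noteq> v"
proof -
  have "card e = 2" using assms(1,2) unfolding simple_graph_def nsets_def by auto
  then obtain x y where "e = {x, y}" "x \<noteq> y" by (auto simp: card_2_iff)
  then show thesis using that assms(3) by (cases "v = x") auto
qed

lemma degree_eq_card_neighbours:
  assumes "simple_graph V E"
  shows "degree E v = card {w. {v, w} \<in> E}"
proof -
  have "bij_betw (\<lambda>w. {v, w}) {w. {v, w} \<in> E} {e \<in> E. v \<in> e}"
    unfolding bij_betw_def
  proof
    show "inj_on (\<lambda>w. {v, w}) {w. {v, w} \<in> E}"
      by (auto simp: inj_on_def doubleton_eq_iff)
    show "(\<lambda>w. {v, w}) ` {w. {v, w} \<in> E} = {e \<in> E. v \<in> e}"
      using simple_graph_edgeE[OF assms] by (auto simp: image_iff) metis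
  qed
  then show ?thesis unfolding degree_def using bij_betw_same_card by fastforce
qed

definition complement_rel :: "'a set \<Rightarrow> 'a set set \<Rightarrow> ('a \<times> 'a) set" where
  "complement_rel V E = {(a, b). a \<in> V \<and> b \<in> V \<and> a \<noteq> b \<and> {a, b} \<notin> E}"

lemma degree_complement_rel:
  assumes "simple_graph V E" "v \<in> V"
  shows "degree E v + outdeg (complement_rel V E) v + 1 = card V"
proof -
  have fin: "finite V" using assms by (simp add: simple_graph_def)
  define N where "N = {w. {v, w} \<in> E}"
  define M where "M = {b. (v, b) \<in> complement_rel V E}"
  have "V = N \<union> M \<union> {v}" "N \<inter> M = {}" "v \<notin> N" "v \<notin> M"
    using assms simple_graph_edge[OF assms(1), of v] simple_graph_edge(3)[OF assms(1), of v v]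
    unfolding N_def M_def complement_rel_def by auto
  moreover from this fin have "finite N" "finite M" by (metis finite_Un)+
  ultimately have "card V = card N + card M + 1" by (simp add: card_Un_disjoint)
  then show ?thesis
    unfolding degree_eq_card_neighbours[OF assms(1)] outdeg_def N_def M_def by simp
qed

lemma exists_lowest_subset:
  fixes d :: "'a \<Rightarrow> nat"
  assumes "finite V" "m \<le> card V"
  shows "\<exists>K\<subseteq>V. card K = m \<and> (\<forall>u\<in>K. \<forall>w\<in>V - K. d u \<le> d w)"
  using assms(2)
proof (induction m)
  case 0
  then show ?case by (intro exI[of _ "{}"]) auto
next
  case (Suc m)
  then obtain K where K: "K \<subseteq> V" "card K = m" "\<forall>u\<in>K. \<forall>w\<in>V - K. d u \<le> d w" by auto
  have "V - K \<noteq> {}" using K Suc.prems assms(1) by (metis Diff_eq_empty_iff Suc_n_not_le_n subset_antisym)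
  then obtain x where x: "x \<in> V - K" "\<And>y. y \<in> V - K \<Longrightarrow> d x \<le> d y"
    using ex_has_least_nat[of "\<lambda>x. x \<in> V - K" _ d] by blast
  have "finite K" using K assms(1) finite_subset by blast
  then show ?case using K x by (intro exI[of _ "insert x K"]) auto
qed

text \<open>In the complement the clique becomes an independent set \<open>K\<close>, chosen among
  the vertices of lowest complement degree. The lower bound on degrees turns into the upper bound
  \<open>card (V - K)\<close> on complement degrees, which is what \<open>barrier_bound\<close> asks
  for.\<close>

theorem exists_realization_with_clique:
  assumes G: "simple_graph V E" and m: "2 * m \<le> card V"
    and deg: "\<And>v. v \<in> V \<Longrightarrow> m \<le> degree E v + 1"
  obtains F K where "simple_graph V F" "\<And>v. v \<in> V \<Longrightarrow> degree F v = degree E v"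
    "K \<subseteq> V" "card K = m" "clique K F"
proof -
  have fin: "finite V" using G by (simp add: simple_graph_def)
  define H where "H = complement_rel V E"
  define d where "d = outdeg H"
  have HV: "H \<subseteq> V \<times> V" "H\<inverse> = H" "\<And>x. (x, x) \<notin> H"
    unfolding H_def complement_rel_def by (auto simp: insert_commute)
  have finH: "finite H" using HV(1) fin by (meson finite_SigmaI finite_subset)
  have ind: "indeg H v = d v" for v unfolding d_def using HV(2) by (metis outdeg_converse)
  obtain K where K: "K \<subseteq> V" "card K = m" "\<forall>u\<in>K. \<forall>w\<in>V - K. d u \<le> d w"
    using exists_lowest_subset[OF fin, of m d] m by auto
  have cVK: "card (V - K) = card V - m" using K fin by (simp add: card_Diff_subset finite_subset)
  have dmax: "d v \<le> card (V - K)" if "v \<in> V" for v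
    using degree_complement_rel[OF G that] deg[OF that] cVK unfolding d_def H_def by linarith
  \<comment> \<open>The symmetrization compares degrees at all elements of the type; outside
    \<open>V\<close> they are zero.\<close>
  have d0: "outdeg R v = 0" "indeg R v = 0" if "R \<subseteq> V \<times> V" "v \<notin> V" for R :: "('a \<times> 'a) set" and v
  proof -
    have "{b. (v, b) \<in> R} = {}" "{a. (a, v) \<in> R} = {}" using that by auto
    then show "outdeg R v = 0" "indeg R v = 0" unfolding outdeg_def indeg_def by simp_all
  qed
  \<comment> \<open>\<open>H\<close> itself witnesses the cut condition: each of its arcs out of
    \<open>T\<close> either ends in \<open>S\<close>, where the in-degrees sum to
    \<open>sum d S\<close>, or is a pair in \<open>T \<times> (V - S)\<close>.\<close>
  have graphic: "sum d T \<le> sum d S + card (pairs_avoiding V {} \<inter> T \<times> (V - S))"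
    if TS: "T \<subseteq> V" "S \<subseteq> V" for T S
  proof -
    have fTS: "finite T" "finite S" using TS fin finite_subset by blast+
    have finP: "finite (pairs_avoiding V {} \<inter> T \<times> (V - S))" using fTS fin by auto
    have "card (H \<inter> T \<times> UNIV) = (\<Sum>t\<in>T. outdeg (H \<inter> T \<times> UNIV) t)"
      using fTS finH by (intro card_eq_sum_outdeg) auto
    then have "sum d T = card (H \<inter> T \<times> UNIV)"
      by (simp add: d_def outdeg_def)
    also have "\<dots> \<le> card ((H \<inter> UNIV \<times> S) \<union> (pairs_avoiding V {} \<inter> T \<times> (V - S)))"
      using finH finP HV unfolding pairs_avoiding_def by (intro card_mono) auto
    also have "\<dots> \<le> card (H \<inter> UNIV \<times> S) + card (pairs_avoiding V {} \<inter> T \<times> (V - S))"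
      by (rule card_Un_le)
    also have "card (H \<inter> UNIV \<times> S) = (\<Sum>s\<in>S. indeg (H \<inter> UNIV \<times> S) s)"
      using fTS finH by (intro card_eq_sum_indeg) auto
    also have "\<dots> = sum d S"
      by (simp add: ind[symmetric] indeg_def)
    finally show ?thesis .
  qed
  have ev: "even (sum d V)"
  proof -
    have "card H = sum d V" unfolding d_def
      using card_eq_sum_outdeg[of V H] HV(1) fin finH by force
    then show ?thesis using even_card_symmetric[OF finH HV(2,3)] by simp
  qed
  have LV: "pairs_avoiding V K \<subseteq> V \<times> V" unfolding pairs_avoiding_def by auto
  have bound: "sum d T \<le> sum d S + card (pairs_avoiding V K \<inter> T \<times> (V - S))" if "T \<subseteq> V" "S \<subseteq> V" for T S
    using barrier_bound[OF fin K(1) _ dmax _ graphic that] K m by blast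
  obtain R0 where R0: "R0 \<subseteq> pairs_avoiding V K" "\<And>v. v \<in> V \<Longrightarrow> outdeg R0 v = d v"
      "\<And>v. v \<in> V \<Longrightarrow> indeg R0 v = d v"
    by (rule exists_relation_with_degrees[OF fin LV refl bound]) (auto intro: that)
  have "outdeg R0 v = d v" "indeg R0 v = d v" for v
    using R0(2,3)[of v] d0[of R0 v] d0(1)[OF HV(1), of v] R0(1) LV unfolding d_def
    by (metis subset_trans)+
  then obtain R where R: "R \<subseteq> pairs_avoiding V K" "R\<inverse> = R" "\<And>v. outdeg R v = d v"
    using exists_symmetric_relation[OF fin K(1) R0(1) _ _ ev] by blast
  define F where "F = {{a, b} | a b. a \<in> V \<and> b \<in> V \<and> a \<noteq> b \<and> (a, b) \<notin> R}"
  have F: "simple_graph V F"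
    unfolding simple_graph_def F_def nsets_def using fin by auto
  have FR: "{a, b} \<in> F \<longleftrightarrow> a \<in> V \<and> b \<in> V \<and> a \<noteq> b \<and> (a, b) \<notin> R" for a b
    unfolding F_def using R(2) by (auto simp: doubleton_eq_iff)
  have "complement_rel V F = R"
    unfolding complement_rel_def using FR R(1) unfolding pairs_avoiding_def by auto
  then have "degree F v = degree E v" if "v \<in> V" for v
    using degree_complement_rel[OF F that] degree_complement_rel[OF G that] R(3)[of v]
    unfolding d_def H_def by simp
  moreover have "clique K F"
    unfolding clique_def using FR K(1) R(1) unfolding pairs_avoiding_def by auto
  ultimately show thesis using that F K by blast
qed

section \<open>Critical graphs and Gallai's theorem\<close>

definition joined :: "'a set set \<Rightarrow> 'a set \<Rightarrow> 'a set \<Rightarrow> bool" where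
  "joined E A B \<longleftrightarrow> (\<forall>a\<in>A. \<forall>b\<in>B. {a, b} \<in> E)"

lemma joined_sym: "joined E A B \<Longrightarrow> joined E B A"
  unfolding joined_def by (metis insert_commute)

text \<open>Vertex-criticality of the subgraph induced on \<open>S\<close>:
  \<open>chromatic_number S E\<close> sees only edges with both ends in \<open>S\<close>, so induced
  subgraphs are represented by their vertex sets.\<close>

definition critical :: "'a set set \<Rightarrow> 'a set \<Rightarrow> bool" where
  "critical E S \<longleftrightarrow> finite S \<and> (\<forall>x\<in>S. chromatic_number (S - {x}) E < chromatic_number S E)"

locale loopless =
  fixes E :: "'a set set"
  assumes no_loop: "{v} \<notin> E"
begin

section \<open>Chromatic numbers of unions and joins\<close>

abbreviation chi :: "'a set \<Rightarrow> nat" where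
  "chi S \<equiv> chromatic_number S E"

text \<open>Colours may come from any finite set of any type, which spares renaming them to an
  initial segment of the naturals.\<close>

lemma chi_le_card:
  assumes "finite C" "c ` S \<subseteq> C" "\<And>u v. u \<in> S \<Longrightarrow> v \<in> S \<Longrightarrow> {u, v} \<in> E \<Longrightarrow> c u \<noteq> c v"
  shows "chi S \<le> card C"
proof -
  obtain f where f: "bij_betw f C {0..<card C}" using ex_bij_betw_finite_nat[OF assms(1)] by blast
  have "proper_coloring S E (f \<circ> c) (card C)"
    unfolding proper_coloring_def
  proof (intro conjI ballI impI)
    show "(f \<circ> c) v < card C" if "v \<in> S" for v
      using that assms(2) bij_betwE[OF f] by auto
    show "(f \<circ> c) u \<noteq> (f \<circ> c) v" if "u \<in> S" "v \<in> S" "{u, v} \<in> E" for u v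
    proof -
      have "c u \<in> C" "c v \<in> C" "c u \<noteq> c v" using that assms by auto
      then show ?thesis using bij_betw_imp_inj_on[OF f] by (auto dest: inj_onD)
    qed
  qed
  then show ?thesis unfolding chromatic_number_def by (intro Least_le) blast
qed

lemma chi_colouring:
  assumes "finite S"
  obtains c where "proper_coloring S E c (chi S)"
proof -
  obtain f where f: "bij_betw f S {0..<card S}" using ex_bij_betw_finite_nat[OF assms] by blast
  have "f u \<noteq> f v" if "u \<in> S" "v \<in> S" "{u, v} \<in> E" for u v
  proof
    assume "f u = f v"
    then have "u = v" using bij_betw_imp_inj_on[OF f] that by (auto dest: inj_onD)
    then show False using that no_loop by simp
  qed
  then have "proper_coloring S E f (card S)"
    unfolding proper_coloring_def using bij_betwE[OF f] by auto
  then have "\<exists>k c. proper_coloring S E c k" by blast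
  then have "\<exists>c. proper_coloring S E c (chi S)" unfolding chromatic_number_def by (rule LeastI_ex)
  then show thesis using that by blast
qed

lemma chi_mono:
  assumes "finite T" "S \<subseteq> T"
  shows "chi S \<le> chi T"
proof -
  obtain c where "proper_coloring T E c (chi T)" using chi_colouring[OF assms(1)] .
  then have "chi S \<le> card {..<chi T}"
    using assms(2) unfolding proper_coloring_def by (intro chi_le_card[of _ c]) auto
  then show ?thesis by simp
qed

lemma chi_Un_le:
  assumes "finite S" "finite T"
  shows "chi (S \<union> T) \<le> chi S + chi T"
proof -
  obtain c where c: "proper_coloring S E c (chi S)" using chi_colouring[OF assms(1)] .
  obtain c' where c': "proper_coloring T E c' (chi T)" using chi_colouring[OF assms(2)] .
  let ?c = "\<lambda>v. if v \<in> S then c v else chi S + c' v"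
  have lt: "c v < chi S" if "v \<in> S" for v using c that unfolding proper_coloring_def by auto
  have lt': "c' v < chi T" if "v \<in> T" for v using c' that unfolding proper_coloring_def by auto
  have "chi (S \<union> T) \<le> card {..<chi S + chi T}"
  proof (rule chi_le_card[of _ ?c])
    show "?c ` (S \<union> T) \<subseteq> {..<chi S + chi T}" using lt lt' by force
    show "?c u \<noteq> ?c v" if "u \<in> S \<union> T" "v \<in> S \<union> T" "{u, v} \<in> E" for u v
      using that c c' lt[of u] lt[of v] unfolding proper_coloring_def by auto
  qed simp
  then show ?thesis by simp
qed

lemma chi_empty [simp]: "chi {} = 0"
  using chi_le_card[of "{}" "\<lambda>_. ()" "{}"] by simp

lemma chi_independent_le_1:
  assumes "\<And>u v. u \<in> S \<Longrightarrow> v \<in> S \<Longrightarrow> {u, v} \<notin> E"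
  shows "chi S \<le> 1"
  using chi_le_card[of "{0 :: nat}" "\<lambda>_. 0" S] assms by auto

lemma chi_pos:
  assumes "finite S" "S \<noteq> {}"
  shows "1 \<le> chi S"
proof -
  obtain c where "proper_coloring S E c (chi S)" using chi_colouring[OF assms(1)] .
  then show ?thesis using assms(2) unfolding proper_coloring_def by fastforce
qed

lemma chi_singleton [simp]: "chi {x} = 1"
  using chi_pos[of "{x}"] chi_independent_le_1[of "{x}"] no_loop by fastforce

text \<open>No colour can occur on both sides of a join, so the colour sets of the two sides add
  up.\<close>

lemma chi_joined:
  assumes "finite S" "finite T" "joined E S T"
  shows "chi (S \<union> T) = chi S + chi T"
proof (rule antisym)
  show "chi (S \<union> T) \<le> chi S + chi T" by (rule chi_Un_le[OF assms(1,2)])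
  obtain c where c: "proper_coloring (S \<union> T) E c (chi (S \<union> T))"
    using chi_colouring[of "S \<union> T"] assms(1,2) by auto
  have "chi S \<le> card (c ` S)" "chi T \<le> card (c ` T)"
    using c assms(1,2) unfolding proper_coloring_def by (intro chi_le_card[of _ c]; auto)+
  moreover have "c ` S \<inter> c ` T = {}"
    using c assms(3) unfolding proper_coloring_def joined_def by auto
  then have "card (c ` S) + card (c ` T) = card (c ` S \<union> c ` T)"
    using assms by (simp add: card_Un_disjoint)
  moreover have "card (c ` S \<union> c ` T) \<le> card {..<chi (S \<union> T)}"
    using c unfolding proper_coloring_def by (intro card_mono) auto
  ultimately show "chi S + chi T \<le> chi (S \<union> T)" by simp
qed

lemma joined_disjoint: "joined E A B \<Longrightarrow> A \<inter> B = {}"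
  unfolding joined_def using no_loop by fastforce

lemma chi_UN_le:
  assumes "finite I" "\<And>i. i \<in> I \<Longrightarrow> finite (A i)"
  shows "chi (\<Union>i\<in>I. A i) \<le> (\<Sum>i\<in>I. chi (A i))"
  using assms
proof (induction I rule: finite_induct)
  case (insert i I)
  then have "chi (A i \<union> (\<Union>i\<in>I. A i)) \<le> chi (A i) + chi (\<Union>i\<in>I. A i)"
    by (intro chi_Un_le) auto
  then show ?case using insert by force
qed simp

lemma chi_Union_joined:
  assumes "finite \<P>" "\<And>P. P \<in> \<P> \<Longrightarrow> finite P"
    and "\<And>P Q. P \<in> \<P> \<Longrightarrow> Q \<in> \<P> \<Longrightarrow> P \<noteq> Q \<Longrightarrow> joined E P Q"
  shows "chi (\<Union>\<P>) = (\<Sum>P\<in>\<P>. chi P)"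
  using assms
proof (induction \<P> rule: finite_induct)
  case (insert P \<P>)
  have "joined E P (\<Union>\<P>)" unfolding joined_def
  proof (intro ballI)
    fix a b assume "a \<in> P" "b \<in> \<Union>\<P>"
    then obtain Q where "Q \<in> \<P>" "b \<in> Q" by auto
    moreover from this have "joined E P Q" using insert by blast
    ultimately show "{a, b} \<in> E" using \<open>a \<in> P\<close> unfolding joined_def by blast
  qed
  then have "chi (P \<union> \<Union>\<P>) = chi P + chi (\<Union>\<P>)"
    using insert by (intro chi_joined) auto
  then show ?case using insert by simp
qed simp

lemma chi_insert_le: "finite S \<Longrightarrow> chi (insert x S) \<le> chi S + 1"
  using chi_Un_le[of S "{x}"] by simp

section \<open>Critical sets\<close>

lemma critical_finite: "critical E S \<Longrightarrow> finite S"
  by (simp add: critical_def)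

text \<open>A subset of least size with the same chromatic number is critical.\<close>

lemma exists_critical_subset:
  assumes "finite S"
  obtains T where "T \<subseteq> S" "critical E T" "chi T = chi S"
proof -
  obtain T where T: "T \<subseteq> S" "chi T = chi S"
    and mn: "\<And>T'. T' \<subseteq> S \<and> chi T' = chi S \<Longrightarrow> card T \<le> card T'"
    using ex_has_least_nat[of "\<lambda>T. T \<subseteq> S \<and> chi T = chi S" S card] by blast
  have fin: "finite T" using T assms finite_subset by blast
  have "chi (T - {x}) < chi T" if "x \<in> T" for x
  proof -
    have "card (T - {x}) < card T" using that fin by (intro psubset_card_mono) auto
    then have "chi (T - {x}) \<noteq> chi S" using mn[of "T - {x}"] T by auto
    then show ?thesis using chi_mono[of T "T - {x}"] fin T by auto
  qed
  then show thesis using that[of T] T fin unfolding critical_def by blast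
qed

lemma critical_subset_eq:
  assumes "critical E S" "T \<subseteq> S" "chi S \<le> chi T"
  shows "T = S"
proof (rule ccontr)
  assume "T \<noteq> S"
  then obtain x where "x \<in> S" "T \<subseteq> S - {x}" using assms(2) by auto
  then have "chi T < chi S"
    using assms(1) chi_mono[of "S - {x}" T] unfolding critical_def by fastforce
  then show False using assms(3) by simp
qed

text \<open>Removing \<open>y\<close> saves a colour, which can then be given to both
  \<open>x\<close> and \<open>y\<close>.\<close>

lemma chi_insert_nonadjacent:
  assumes "critical E S" "y \<in> S" "{x, y} \<notin> E"
  shows "chi (insert x S) \<le> chi S"
proof -
  have fin: "finite S" using assms(1) critical_finite by simp
  have "insert x S = (S - {y}) \<union> {x, y}" using assms(2) by auto
  then have "chi (insert x S) \<le> chi (S - {y}) + chi {x, y}"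
    using chi_Un_le[of "S - {y}" "{x, y}"] fin by simp
  moreover have "chi {x, y} \<le> 1"
    using assms(3) no_loop by (intro chi_independent_le_1) (auto simp: insert_commute)
  moreover have "chi (S - {y}) < chi S" using assms unfolding critical_def by auto
  ultimately show ?thesis by simp
qed

lemma critical_joinedD:
  assumes "critical E (A \<union> B)" "joined E A B"
  shows "critical E A"
proof -
  have fin: "finite A" "finite B" using assms(1) critical_finite by auto
  have "chi (A - {x}) < chi A" if "x \<in> A" for x
  proof -
    have "A \<union> B - {x} = (A - {x}) \<union> B" using joined_disjoint[OF assms(2)] that by auto
    moreover have "joined E (A - {x}) B" using assms(2) unfolding joined_def by auto
    ultimately have "chi (A \<union> B - {x}) = chi (A - {x}) + chi B" using chi_joined fin by simp
    moreover have "chi (A \<union> B - {x}) < chi (A \<union> B)" using assms(1) that unfolding critical_def by auto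
    ultimately show ?thesis using chi_joined[OF fin assms(2)] by simp
  qed
  then show ?thesis using fin unfolding critical_def by auto
qed

text \<open>In an optimal colouring of \<open>S - {y}\<close> every colour occurs among the
  neighbours of \<open>y\<close>; a missing one could be given to \<open>y\<close>, against
  criticality.\<close>

lemma critical_degree:
  assumes "critical E S" "y \<in> S"
  shows "chi S \<le> card {z \<in> S. {y, z} \<in> E} + 1"
proof -
  have fin: "finite S" using assms(1) critical_finite by simp
  define N where "N = {z \<in> S. {y, z} \<in> E}"
  have yN: "y \<notin> N" unfolding N_def using no_loop by simp
  obtain c where c: "proper_coloring (S - {y}) E c (chi (S - {y}))"
    using chi_colouring[of "S - {y}"] fin by auto
  have "{..<chi (S - {y})} \<subseteq> c ` N"
  proof (rule ccontr)
    assume "\<not> ?thesis"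
    then obtain j where j: "j < chi (S - {y})" "j \<notin> c ` N" by auto
    have "chi S \<le> card {..<chi (S - {y})}"
    proof (rule chi_le_card[of _ "c(y := j)"])
      show "(c(y := j)) ` S \<subseteq> {..<chi (S - {y})}" using c j unfolding proper_coloring_def by auto
      show "(c(y := j)) u \<noteq> (c(y := j)) v" if "u \<in> S" "v \<in> S" "{u, v} \<in> E" for u v
      proof (cases "u = y \<or> v = y")
        case True
        then show ?thesis using that j(2) no_loop unfolding N_def by (auto simp: insert_commute)
      next
        case False
        then show ?thesis using that c unfolding proper_coloring_def by auto
      qed
    qed simp
    then show False using assms unfolding critical_def by fastforce
  qed
  then have "chi (S - {y}) \<le> card (c ` N)"
    using card_mono[of "c ` N" "{..<chi (S - {y})}"] fin unfolding N_def by simp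
  also have "\<dots> \<le> card N" using fin unfolding N_def by (intro card_image_le) auto
  finally show ?thesis
    using chi_insert_le[of "S - {y}" y] fin assms(2) unfolding N_def by (simp add: insert_absorb)
qed

text \<open>A decomposition of \<open>S\<close> as a join of critical parts satisfying Gallai's
  bound \<open>|P| \<ge> 2 \<chi>(P) - 1\<close>, written without subtraction. The last clause
  separates single vertices from parts large enough for the ratio 3/5.\<close>

definition gallai_partition :: "'a set set \<Rightarrow> 'a set \<Rightarrow> bool" where
  "gallai_partition \<P> S \<longleftrightarrow> finite \<P> \<and> \<Union>\<P> = S \<and>
     (\<forall>P\<in>\<P>. \<forall>Q\<in>\<P>. P \<noteq> Q \<longrightarrow> joined E P Q) \<and>
     (\<forall>P\<in>\<P>. critical E P \<and> P \<noteq> {} \<and> 2 * chi P \<le> card P + 1 \<and> (card P = 1 \<or> 3 \<le> chi P))"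

lemma card_gallai_partition:
  assumes "gallai_partition \<P> S"
  shows "card S = (\<Sum>P\<in>\<P>. card P)"
proof -
  have "pairwise disjnt \<P>"
    using assms joined_disjoint unfolding gallai_partition_def pairwise_def disjnt_def by blast
  moreover have "\<And>P. P \<in> \<P> \<Longrightarrow> finite P"
    using assms critical_finite unfolding gallai_partition_def by blast
  ultimately show ?thesis
    using card_Union_disjoint[of \<P>] assms unfolding gallai_partition_def by metis
qed

text \<open>
  Gallai's theorem that a vertex-critical graph with connected complement has at least
  \<open>2 \<chi> - 1\<close> vertices. Otherwise take a critical \<open>V1 \<subset> S\<close> with \<open>\<chi> - 1\<close> colours
  and its partition, and match the vertices outside \<open>V1\<close> to parts containing a non-neighbour:
  a matched vertex costs no colour, and the barrier to a perfect matching splits \<open>S\<close> as a join.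
\<close>

lemma critical_indecomposable_card:
  assumes crit: "critical E S" and ne: "S \<noteq> {}"
    and indec: "\<And>A B. A \<union> B = S \<Longrightarrow> joined E A B \<Longrightarrow> A = {} \<or> B = {}"
    and IH: "\<And>S'. card S' < card S \<Longrightarrow> critical E S' \<Longrightarrow> \<exists>\<P>. gallai_partition \<P> S'"
  shows "2 * chi S \<le> card S + 1"
proof (rule ccontr)
  assume neg: "\<not> ?thesis"
  have fin: "finite S" using crit critical_finite by simp
  obtain x where x: "x \<in> S" using ne by auto
  have chix: "chi (S - {x}) + 1 = chi S"
    using crit x chi_insert_le[of "S - {x}" x] fin unfolding critical_def by (auto simp: insert_absorb le_Suc_eq)
  obtain V1 where V1: "V1 \<subseteq> S - {x}" "critical E V1" "chi V1 = chi (S - {x})"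
    using exists_critical_subset[of "S - {x}"] fin by auto
  have "V1 \<subset> S" using V1(1) x by auto
  then have "card V1 < card S" using fin by (intro psubset_card_mono)
  then obtain \<P> where P: "gallai_partition \<P> V1" using IH V1(2) by blast
  have finP: "finite \<P>" and UP: "\<Union>\<P> = V1"
    and join: "\<And>P Q. P \<in> \<P> \<Longrightarrow> Q \<in> \<P> \<Longrightarrow> P \<noteq> Q \<Longrightarrow> joined E P Q"
    and part: "\<And>P. P \<in> \<P> \<Longrightarrow> critical E P" "\<And>P. P \<in> \<P> \<Longrightarrow> P \<noteq> {}"
      "\<And>P. P \<in> \<P> \<Longrightarrow> 2 * chi P \<le> card P + 1"
    using P unfolding gallai_partition_def by auto
  have finpart: "finite P" if "P \<in> \<P>" for P using part(1)[OF that] critical_finite by simp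
  define U where "U = S - V1"
  have finU: "finite U" using fin U_def by simp
  have cU: "card U + card V1 = card S"
    using fin V1(1) unfolding U_def by (metis Diff_subset card_Diff_subset card_mono dual_order.trans
        finite_subset le_add_diff_inverse2)
  have chiP: "chi V1 = (\<Sum>P\<in>\<P>. chi P)"
    using chi_Union_joined[OF finP finpart join] UP by simp
  \<comment> \<open>Summing the bound over the parts gives
    \<open>2 \<chi>(V1) \<le> |V1| + |\<P>|\<close>, while the negated claim gives
    \<open>2 \<chi>(V1) \<ge> |S|\<close>; hence there are at least as many parts as vertices in
    \<open>U\<close>.\<close>
  have "2 * chi V1 = (\<Sum>P\<in>\<P>. 2 * chi P)" unfolding chiP by (rule sum_distrib_left)
  also have "\<dots> \<le> (\<Sum>P\<in>\<P>. card P + 1)" using part(3) by (rule sum_mono)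
  also have "\<dots> = card V1 + card \<P>"
    unfolding sum.distrib using card_gallai_partition[OF P] by simp
  finally have cardP: "card U \<le> card \<P>" using neg chix V1(3) cU by linarith
  define L where "L = {(u, P). u \<in> U \<and> P \<in> \<P> \<and> (\<exists>y\<in>P. {u, y} \<notin> E)}"
  have LUP: "L \<subseteq> U \<times> \<P>" unfolding L_def by auto
  obtain R T \<S> where R: "feasible L (\<lambda>_. 1) (\<lambda>_. 1) R" "T \<subseteq> U" "\<S> \<subseteq> \<P>"
    "\<And>a. a \<in> U \<Longrightarrow> a \<notin> T \<Longrightarrow> outdeg R a = 1"
    "L \<inter> T \<times> (\<P> - \<S>) \<subseteq> R"
    "\<And>b. b \<in> \<S> \<Longrightarrow> indeg R b = 1"
    "\<And>a b. (a, b) \<in> R \<Longrightarrow> b \<in> \<S> \<Longrightarrow> a \<in> T"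
    "\<And>t. t \<in> T \<Longrightarrow> outdeg R t = 1 \<Longrightarrow> \<exists>s\<in>\<S>. (t, s) \<in> R"
    "T \<noteq> {} \<Longrightarrow> \<exists>t\<in>T. outdeg R t < 1"
    by (rule degree_constrained_barrier[OF finU finP LUP, where r = "\<lambda>_. 1" and c = "\<lambda>_. 1"]) (rule that)
  have RL: "R \<subseteq> L" "\<And>a. outdeg R a \<le> 1" "\<And>b. indeg R b \<le> 1" using R(1) unfolding feasible_def by auto
  have finR: "finite R" using RL(1) LUP finU finP by (meson finite_SigmaI finite_subset)
  have fun_out: "P = Q" if "(u, P) \<in> R" "(u, Q) \<in> R" for u P Q
    using RL(2)[of u] that finite_out[OF finR, of u] unfolding outdeg_def
    by (auto simp: card_le_Suc0_iff_eq)
  have fun_in: "u = v" if "(u, P) \<in> R" "(v, P) \<in> R" for u v P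
    using RL(3)[of P] that finite_in[OF finR, of P] unfolding indeg_def
    by (auto simp: card_le_Suc0_iff_eq)
  \<comment> \<open>A non-neighbour of \<open>t\<close> in such a part would put
    \<open>(t, P)\<close> into \<open>R\<close>, making \<open>t\<close> a full row; but its only
    pair then goes to a part in \<open>\<S>\<close>.\<close>
  have TP: "joined E T P" if P: "P \<in> \<P> - \<S>" for P
    unfolding joined_def
  proof (intro ballI, rule ccontr)
    fix t y assume t: "t \<in> T" and y: "y \<in> P" and n: "{t, y} \<notin> E"
    then have tP: "(t, P) \<in> R" using R(2,5) P unfolding L_def by auto
    then have "outdeg R t > 0" unfolding outdeg_def using finite_out[OF finR] by (auto simp: card_gt_0_iff)
    then have "outdeg R t = 1" using RL(2)[of t] by simp
    then obtain Q where "Q \<in> \<S>" "(t, Q) \<in> R" using R(8) t by blast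
    then show False using fun_out[OF tP] P by auto
  qed
  define Z where "Z = T \<union> \<Union>\<S>"
  define Y where "Y = \<Union>(\<P> - \<S>)"
  \<comment> \<open>\<open>A P\<close> is the part together with the vertex matched to it, if that
    vertex lies outside \<open>T\<close>; a non-neighbour in \<open>P\<close> makes the extra vertex
    free of charge.\<close>
  define A where "A P = P \<union> {u \<in> U - T. (u, P) \<in> R}" for P
  have finZ: "finite Z"
    using R(2,3) finU finpart finite_subset[OF R(2) finU] finite_subset[OF R(3) finP]
    unfolding Z_def by auto
  have finY: "finite Y" using finP finpart unfolding Y_def by auto
  have finA: "finite (A P)" if "P \<in> \<P>" for P using finpart[OF that] finU unfolding A_def by auto
  have ZY: "joined E Z Y"
    unfolding joined_def
  proof (intro ballI)
    fix a b assume a: "a \<in> Z" and b: "b \<in> Y"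
    then obtain P where P: "P \<in> \<P> - \<S>" "b \<in> P" unfolding Y_def by auto
    show "{a, b} \<in> E"
    proof (cases "a \<in> T")
      case True
      then show ?thesis using TP[OF P(1)] P(2) unfolding joined_def by auto
    next
      case False
      then obtain Q where "Q \<in> \<S>" "a \<in> Q" using a unfolding Z_def by auto
      moreover from this have "joined E Q P" using R(3) P by (intro join) auto
      ultimately show ?thesis using P(2) unfolding joined_def by auto
    qed
  qed
  have chiA: "chi (A P) \<le> chi P" if P: "P \<in> \<P>" for P
  proof (cases "\<exists>u. u \<in> U - T \<and> (u, P) \<in> R")
    case True
    then obtain u where u: "u \<in> U - T" "(u, P) \<in> R" by blast
    then have "A P = insert u P" unfolding A_def using fun_in by auto
    moreover obtain y where "y \<in> P" "{u, y} \<notin> E" using u RL(1) unfolding L_def by auto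
    ultimately show ?thesis using chi_insert_nonadjacent part(1)[OF P] by simp
  next
    case False
    then have "A P = P" unfolding A_def by auto
    then show ?thesis by simp
  qed
  have cover: "S \<subseteq> Z \<union> (\<Union>P\<in>\<P> - \<S>. A P)"
  proof
    fix v assume v: "v \<in> S"
    consider "v \<in> T" | "v \<in> V1" | "v \<in> U" "v \<notin> T" using v U_def by auto
    then show "v \<in> Z \<union> (\<Union>P\<in>\<P> - \<S>. A P)"
    proof cases
      case 1 then show ?thesis unfolding Z_def by auto
    next
      case 2 then show ?thesis using UP unfolding Z_def A_def by auto
    next
      case 3
      then have "outdeg R v = 1" using R(4) by simp
      then obtain P where "(v, P) \<in> R" unfolding outdeg_def by (auto simp: card_1_singleton_iff)
      then show ?thesis using 3 R(7) RL(1) LUP unfolding A_def by blast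
    qed
  qed
  \<comment> \<open>Dropping the matched vertices outside \<open>T\<close> costs no colour, so
    \<open>Z \<union> Y\<close> needs as many colours as \<open>S\<close> and by criticality is all
    of \<open>S\<close>.\<close>
  have "chi S \<le> chi (Z \<union> (\<Union>P\<in>\<P> - \<S>. A P))"
    using cover finZ finP finA by (intro chi_mono) auto
  also have "\<dots> \<le> chi Z + chi (\<Union>P\<in>\<P> - \<S>. A P)"
    using finZ finP finA by (intro chi_Un_le) auto
  also have "chi (\<Union>P\<in>\<P> - \<S>. A P) \<le> (\<Sum>P\<in>\<P> - \<S>. chi (A P))"
    using finP finA by (intro chi_UN_le) auto
  also have "\<dots> \<le> (\<Sum>P\<in>\<P> - \<S>. chi P)" using chiA by (intro sum_mono) auto
  also have "\<dots> = chi Y"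
    unfolding Y_def using finP finpart join by (intro chi_Union_joined[symmetric]) auto
  also have "chi Z + chi Y = chi (Z \<union> Y)" using chi_joined[OF finZ finY ZY] by simp
  finally have "chi S \<le> chi (Z \<union> Y)" by simp
  moreover have ZYS: "Z \<union> Y \<subseteq> S"
    using R(2,3) UP V1(1) unfolding Z_def Y_def U_def by auto
  ultimately have eq: "Z \<union> Y = S" using critical_subset_eq[OF crit] by blast
  \<comment> \<open>The vertex \<open>x\<close> makes \<open>Z\<close> nonempty, so
    indecomposability leaves \<open>Y\<close> empty. Then every part is matched while some row is
    not, so \<open>|\<P>| < |U|\<close>.\<close>
  have "x \<notin> V1" using V1(1) by auto
  then have xT: "x \<in> T" using eq x R(3) UP unfolding Z_def Y_def by auto
  then have "Y = {}" using indec[OF eq ZY] unfolding Z_def by auto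
  then have SP: "\<S> = \<P>" using part(2) R(3) unfolding Y_def by auto
  have "card \<P> = card R"
    using card_eq_sum_indeg[OF finP finR] RL(1) LUP R(6) SP by force
  also have "\<dots> = (\<Sum>u\<in>U. outdeg R u)"
    using RL(1) LUP by (intro card_eq_sum_outdeg[OF finU finR]) auto
  also have "\<dots> < (\<Sum>u\<in>U. 1)"
    using R(9,2) xT RL(2) finU by (intro sum_strict_mono_ex1) auto
  finally show False using cardP by simp
qed

text \<open>Induction on the size: both sides of a proper join are again critical and their
  partitions unite, while an indecomposable set is its own single part.\<close>

theorem exists_gallai_partition:
  assumes "critical E S"
  shows "\<exists>\<P>. gallai_partition \<P> S"
  using assms
proof (induction "card S" arbitrary: S rule: less_induct)
  case less
  have fin: "finite S" using less.prems critical_finite by simp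
  consider "S = {}" | A B where "A \<union> B = S" "joined E A B" "A \<noteq> {}" "B \<noteq> {}"
    | "S \<noteq> {}" "\<And>A B. A \<union> B = S \<Longrightarrow> joined E A B \<Longrightarrow> A = {} \<or> B = {}" by blast
  then show ?case
  proof cases
    case 1
    then show ?thesis by (intro exI[of _ "{}"]) (auto simp: gallai_partition_def)
  next
    case 2
    have "A \<inter> B = {}" using joined_disjoint[OF 2(2)] .
    then have "A \<subset> S" "B \<subset> S" using 2 by auto
    then have "card A < card S" "card B < card S" using fin psubset_card_mono by blast+
    moreover have "critical E A" using critical_joinedD[of A B] 2 less.prems by simp
    moreover have "critical E B"
      using critical_joinedD[of B A] joined_sym[OF 2(2)] 2(1) less.prems by (simp add: Un_commute)
    ultimately obtain PA PB where PA: "gallai_partition PA A" and PB: "gallai_partition PB B"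
      using less.hyps by blast
    have cross: "joined E P Q" "joined E Q P" if "P \<in> PA" "Q \<in> PB" for P Q
    proof -
      have "P \<subseteq> A" "Q \<subseteq> B" using that PA PB unfolding gallai_partition_def by auto
      then show "joined E P Q" using 2(2) unfolding joined_def by blast
      then show "joined E Q P" by (rule joined_sym)
    qed
    have "gallai_partition (PA \<union> PB) S"
      using PA PB 2(1) cross unfolding gallai_partition_def by auto
    then show ?thesis by blast
  next
    case 3
    have "2 * chi S \<le> card S + 1"
      using critical_indecomposable_card[OF less.prems 3(1)] 3(2) less.hyps by blast
    \<comment> \<open>A critical set with an edge and fewer than three colours consists of the two
      ends of that edge, which is a join of single vertices and hence decomposable.\<close>
    moreover have "card S = 1 \<or> 3 \<le> chi S"
    proof (rule disjCI)
      assume n3: "\<not> 3 \<le> chi S"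
      show "card S = 1"
      proof (cases "\<exists>u v. u \<in> S \<and> v \<in> S \<and> {u, v} \<in> E")
        case True
        then obtain u v where uv: "u \<in> S" "v \<in> S" "{u, v} \<in> E" by blast
        have j: "joined E {u} {v}" using uv unfolding joined_def by simp
        have "chi {u, v} = 2" using chi_joined[OF _ _ j] by (simp add: insert_commute)
        then have "{u} \<union> {v} = S"
          using critical_subset_eq[OF less.prems, of "{u, v}"] uv n3 by (simp add: insert_commute)
        then show ?thesis using 3(2) j by blast
      next
        case False
        then have c1: "chi S \<le> 1" using chi_independent_le_1 by blast
        obtain x where x: "x \<in> S" using 3(1) by auto
        have "{x} = S" using critical_subset_eq[OF less.prems, of "{x}"] x c1 by simp
        then show ?thesis by (metis card_1_singleton_iff One_nat_def)
      qed
    qed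
    ultimately have "gallai_partition {S} S"
      using less.prems 3(1) unfolding gallai_partition_def by auto
    then show ?thesis by blast
  qed
qed

text \<open>\<open>U\<close> collects the one-vertex parts of a Gallai partition and
  \<open>W\<close> the others. For a part with \<open>\<chi> \<ge> 3\<close>, Gallai's bound gives
  \<open>3 |P| \<ge> 6 \<chi> - 3 \<ge> 5 \<chi>\<close>, and both sides are additive over the
  join.\<close>

lemma critical_split_universal:
  assumes "critical E S"
  obtains U W where "U \<union> W = S" "U \<inter> W = {}" "clique U E" "joined E U W" "critical E W"
    "chi S = card U + chi W" "5 * chi W \<le> 3 * card W"
proof -
  obtain \<P> where P: "gallai_partition \<P> S" using exists_gallai_partition[OF assms] by blast
  have finP: "finite \<P>" and UP: "\<Union>\<P> = S"
    and join: "\<And>P Q. P \<in> \<P> \<Longrightarrow> Q \<in> \<P> \<Longrightarrow> P \<noteq> Q \<Longrightarrow> joined E P Q"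
    and part: "\<And>P. P \<in> \<P> \<Longrightarrow> critical E P" "\<And>P. P \<in> \<P> \<Longrightarrow> 2 * chi P \<le> card P + 1"
      "\<And>P. P \<in> \<P> \<Longrightarrow> card P = 1 \<or> 3 \<le> chi P"
    using P unfolding gallai_partition_def by auto
  have finpart: "finite P" if "P \<in> \<P>" for P using part(1)[OF that] critical_finite by simp
  define \<U> where "\<U> = {P \<in> \<P>. card P = 1}"
  define U where "U = \<Union>\<U>"
  define W where "W = \<Union>(\<P> - \<U>)"
  have UW: "U \<union> W = S" using UP unfolding U_def W_def \<U>_def by auto
  have jUW: "joined E U W"
    unfolding joined_def
  proof (intro ballI)
    fix a b assume "a \<in> U" "b \<in> W"
    then obtain P Q where "P \<in> \<U>" "a \<in> P" "Q \<in> \<P> - \<U>" "b \<in> Q" unfolding U_def W_def by auto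
    moreover from this have "joined E P Q" unfolding \<U>_def by (intro join) auto
    ultimately show "{a, b} \<in> E" unfolding joined_def by auto
  qed
  have cl: "clique U E"
    unfolding clique_def
  proof (intro ballI impI)
    fix a b assume "a \<in> U" "b \<in> U" "a \<noteq> b"
    then obtain P Q where PQ: "P \<in> \<U>" "a \<in> P" "Q \<in> \<U>" "b \<in> Q" unfolding U_def by auto
    then have "P \<noteq> Q" using \<open>a \<noteq> b\<close> unfolding \<U>_def by (auto simp: card_1_singleton_iff)
    then have "joined E P Q" using PQ unfolding \<U>_def by (intro join) auto
    then show "{a, b} \<in> E" using PQ unfolding joined_def by auto
  qed
  have finUW: "finite U" "finite W" using UW assms critical_finite by (metis finite_Un)+
  have critW: "critical E W"
    using critical_joinedD[of W U] joined_sym[OF jUW] UW assms by (simp add: Un_commute)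
  have disj: "pairwise disjnt \<Q>" if "\<Q> \<subseteq> \<P>" for \<Q>
    using that join joined_disjoint unfolding pairwise_def disjnt_def by blast
  have cardU: "card (\<Union>\<Q>) = (\<Sum>P\<in>\<Q>. card P)" if "\<Q> \<subseteq> \<P>" for \<Q>
    using that finpart by (intro card_Union_disjoint disj) auto
  have chiQ: "chi (\<Union>\<Q>) = (\<Sum>P\<in>\<Q>. chi P)" if "\<Q> \<subseteq> \<P>" for \<Q>
    using that finite_subset[OF that finP] finpart by (intro chi_Union_joined join) auto
  have "chi P = card P" if "P \<in> \<U>" for P
    using that unfolding \<U>_def by (auto simp: card_1_singleton_iff)
  then have "chi U = card U"
    unfolding U_def using chiQ[of \<U>] cardU[of \<U>] unfolding \<U>_def by (auto intro!: sum.cong)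
  then have chiS: "chi S = card U + chi W" using chi_joined[OF finUW jUW] UW by simp
  have "5 * chi W = (\<Sum>P\<in>\<P> - \<U>. 5 * chi P)"
    unfolding W_def using chiQ[of "\<P> - \<U>"] by (simp add: sum_distrib_left)
  also have "\<dots> \<le> (\<Sum>P\<in>\<P> - \<U>. 3 * card P)"
  proof (rule sum_mono)
    fix P assume "P \<in> \<P> - \<U>"
    then have "3 \<le> chi P" "2 * chi P \<le> card P + 1" using part[of P] unfolding \<U>_def by auto
    then show "5 * chi P \<le> 3 * card P" by linarith
  qed
  also have "\<dots> = 3 * card W"
    unfolding W_def using cardU[of "\<P> - \<U>"] by (simp add: sum_distrib_left)
  finally show thesis using that UW joined_disjoint[OF jUW] cl jUW critW chiS by blast
qed

end

section \<open>The bound\<close>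

lemma clique_number_ge:
  assumes "finite W" "K \<subseteq> W" "clique K F"
  shows "card K \<le> clique_number W F"
  unfolding clique_number_def
  by (rule Max_ge) (use assms in \<open>auto intro: finite_subset[of _ "card ` Pow W"]\<close>)

lemma clique_number_le:
  assumes "finite W"
  shows "clique_number W F \<le> card W"
proof -
  let ?A = "{card K | K. K \<subseteq> W \<and> clique K F}"
  have "finite ?A" by (rule finite_subset[of _ "card ` Pow W"]) (use assms in auto)
  moreover have "?A \<noteq> {}" by (auto simp: clique_def intro!: exI[of _ "{}"])
  ultimately have "Max ?A \<in> ?A" by (rule Max_in)
  then show ?thesis unfolding clique_number_def using assms by (auto intro: card_mono)
qed

lemma length_degree_sequence:
  assumes "finite W"
  shows "length (degree_sequence W F) = card W"
proof -
  have "length (degree_sequence W F) = size (mset (sorted_list_of_multiset (image_mset (degree F) (mset_set W))))"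
    unfolding degree_sequence_def by (metis length_rev size_mset)
  also have "\<dots> = card W" by simp
  finally show ?thesis .
qed

text \<open>The graph is copied along an injection onto vertices in \<open>nat\<close>, as the
  definition of \<open>seq_clique_number\<close> requires.\<close>

lemma seq_clique_number_ge:
  assumes G: "simple_graph V E" and K: "K \<subseteq> V" "clique K E"
  shows "card K \<le> seq_clique_number (degree_sequence V E)"
proof -
  have fin: "finite V" using G by (simp add: simple_graph_def)
  obtain f :: "'a \<Rightarrow> nat" where "bij_betw f V {0..<card V}" using ex_bij_betw_finite_nat[OF fin] by blast
  then have inj: "inj_on f V" by (rule bij_betw_imp_inj_on)
  define F where "F = (`) f ` E"
  have EV: "e \<subseteq> V" "card e = 2" if "e \<in> E" for e
    using G that unfolding simple_graph_def nsets_def by auto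
  have F: "simple_graph (f ` V) F"
    unfolding simple_graph_def nsets_def F_def
  proof (intro conjI subsetI)
    fix e' assume "e' \<in> (`) f ` E"
    then obtain e where e: "e \<in> E" "e' = f ` e" by auto
    then have "card e' = 2" using card_image[OF inj_on_subset[OF inj]] EV by auto
    moreover have "finite e'" using calculation card.infinite by fastforce
    ultimately show "e' \<in> {N. N \<subseteq> f ` V \<and> finite N \<and> card N = 2}" using e EV by auto
  qed (use fin in auto)
  have inE: "inj_on ((`) f) E"
    using inj EV(1) by (meson Pow_iff inj_on_image_Pow inj_on_subset subsetI)
  have deg: "degree F (f v) = degree E v" if v: "v \<in> V" for v
  proof -
    have "{e' \<in> F. f v \<in> e'} = (`) f ` {e \<in> E. v \<in> e}"
    proof -
      have "f v \<in> f ` e \<longleftrightarrow> v \<in> e" if "e \<in> E" for e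
        using inj_on_image_mem_iff[OF inj v EV(1)[OF that]] .
      then show ?thesis unfolding F_def by auto
    qed
    then show ?thesis unfolding degree_def
      using card_image[OF inj_on_subset[OF inE, of "{e \<in> E. v \<in> e}"]] by auto
  qed
  have "image_mset (degree F) (mset_set (f ` V)) = image_mset (degree F) (image_mset f (mset_set V))"
    using image_mset_mset_set[OF inj] by simp
  also have "\<dots> = image_mset (degree E) (mset_set V)"
    unfolding multiset.map_comp by (rule image_mset_cong) (use deg fin in auto)
  finally have seq: "degree_sequence (f ` V) F = degree_sequence V E"
    unfolding degree_sequence_def by simp
  have "clique (f ` K) F"
    unfolding clique_def
  proof (intro ballI impI)
    fix a b assume "a \<in> f ` K" "b \<in> f ` K" "a \<noteq> b"
    then obtain u v where uv: "u \<in> K" "v \<in> K" "a = f u" "b = f v" "u \<noteq> v" by auto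
    then have "{u, v} \<in> E" using K(2) unfolding clique_def by auto
    then show "{a, b} \<in> F" unfolding F_def using uv by (auto intro: image_eqI[of _ _ "{u, v}"])
  qed
  then have "card (f ` K) \<le> clique_number (f ` V) F"
    using fin K(1) by (intro clique_number_ge) auto
  moreover have "card (f ` K) = card K" using inj K(1) by (meson card_image inj_on_subset)
  moreover have "clique_number (f ` V) F \<le> seq_clique_number (degree_sequence V E)"
    unfolding seq_clique_number_def
  proof (rule Max_ge)
    \<comment> \<open>The length of the sequence fixes the order of every realization and thus
      bounds its clique number, so the maximum is over a finite set.\<close>
    have "clique_number W F' \<le> length (degree_sequence V E)"
      if "simple_graph W F'" "degree_sequence W F' = degree_sequence V E" for W :: "nat set" and F'
      using that clique_number_le[of W F'] length_degree_sequence[of W F'] by (simp add: simple_graph_def)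
    then have "{clique_number W F' | (W :: nat set) F'.
        simple_graph W F' \<and> degree_sequence W F' = degree_sequence V E}
      \<subseteq> {..length (degree_sequence V E)}"
      by blast
    then show "finite {clique_number W F' | (W :: nat set) F'.
        simple_graph W F' \<and> degree_sequence W F' = degree_sequence V E}"
      by (rule finite_subset) simp
    show "clique_number (f ` V) F \<in> {clique_number W F' | (W :: nat set) F'.
        simple_graph W F' \<and> degree_sequence W F' = degree_sequence V E}"
      using F seq by blast
  qed
  ultimately show ?thesis by simp
qed

section \<open>Substituting a realization of an induced subgraph\<close>

lemma degree_sequence_cong:
  assumes "finite V" "\<And>v. v \<in> V \<Longrightarrow> degree E v = degree F v"
  shows "degree_sequence V E = degree_sequence V F"
proof -
  have "image_mset (degree E) (mset_set V) = image_mset (degree F) (mset_set V)"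
    by (rule image_mset_cong) (use assms in auto)
  then show ?thesis unfolding degree_sequence_def by simp
qed

text \<open>Edges not contained in \<open>W\<close> stay, and inside \<open>W\<close> the degrees
  agree, so exchanging the graph on \<open>W\<close> changes no degree.\<close>

lemma degree_replace_induced:
  assumes G: "simple_graph V E" and W: "W \<subseteq> V" and F: "simple_graph W F"
    and deg: "\<And>v. v \<in> W \<Longrightarrow> degree F v = degree {e \<in> E. e \<subseteq> W} v"
  shows "simple_graph V ({e \<in> E. \<not> e \<subseteq> W} \<union> F)"
    and "degree ({e \<in> E. \<not> e \<subseteq> W} \<union> F) v = degree E v"
proof -
  have FW: "e \<subseteq> W" if "e \<in> F" for e using that F unfolding simple_graph_def nsets_def by auto
  show "simple_graph V ({e \<in> E. \<not> e \<subseteq> W} \<union> F)"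
    using G F W unfolding simple_graph_def nsets_def by auto
  have finE: "finite E" "finite F"
    using G F finite_imp_finite_nsets unfolding simple_graph_def by (meson finite_subset)+
  have un: "degree (A \<union> B) v = degree A v + degree B v"
    if "finite A" "finite B" "A \<inter> B = {}" for A B :: "'a set set"
  proof -
    have "{e \<in> A \<union> B. v \<in> e} = {e \<in> A. v \<in> e} \<union> {e \<in> B. v \<in> e}" by auto
    then show ?thesis unfolding degree_def using that by (simp add: card_Un_disjoint disjoint_iff)
  qed
  have "degree F v = degree {e \<in> E. e \<subseteq> W} v"
  proof (cases "v \<in> W")
    case False
    then have "{e \<in> F. v \<in> e} = {}" "{e \<in> {e \<in> E. e \<subseteq> W}. v \<in> e} = {}" using FW by auto
    then show ?thesis unfolding degree_def by (simp only:)
  qed (rule deg)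
  moreover have "degree ({e \<in> E. \<not> e \<subseteq> W} \<union> F) v = degree {e \<in> E. \<not> e \<subseteq> W} v + degree F v"
    using finE FW by (intro un) auto
  moreover have "degree E v = degree ({e \<in> E. \<not> e \<subseteq> W} \<union> {e \<in> E. e \<subseteq> W}) v"
    by (rule arg_cong[of _ _ "\<lambda>A. degree A v"]) auto
  moreover have "\<dots> = degree {e \<in> E. \<not> e \<subseteq> W} v + degree {e \<in> E. e \<subseteq> W} v"
    using finE by (intro un) auto
  ultimately show "degree ({e \<in> E. \<not> e \<subseteq> W} \<union> F) v = degree E v" by simp
qed

theorem theorem3p2:
  fixes V :: "'a set" and E :: "'a set set"
  assumes "simple_graph V E"
  shows "real (chromatic_number V E)
           \<le> 6 / 5 * real (seq_clique_number (degree_sequence V E)) + 3 / 5"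
proof -
  interpret loopless E
    by unfold_locales (use assms in \<open>auto simp: simple_graph_def nsets_def\<close>)
  have fin: "finite V" using assms by (simp add: simple_graph_def)
  obtain S where S: "S \<subseteq> V" "critical E S" "chi S = chi V" using exists_critical_subset[OF fin] .
  obtain U W where UW: "U \<union> W = S" "U \<inter> W = {}" "clique U E" "joined E U W" "critical E W"
    "chi S = card U + chi W" "5 * chi W \<le> 3 * card W"
    by (rule critical_split_universal[OF S(2)]) (rule that)
  have WV: "W \<subseteq> V" "U \<subseteq> V" using UW(1) S(1) by auto
  define EW where "EW = {e \<in> E. e \<subseteq> W}"
  have GW: "simple_graph W EW"
    using assms WV fin unfolding simple_graph_def nsets_def EW_def by (auto intro: finite_subset)
  \<comment> \<open>\<open>chi W\<close> keeps \<open>m\<close> within the degree bound for critical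
    sets, and half of \<open>|W|\<close> within the size condition of the realization
    theorem.\<close>
  define m where "m = min (chi W) (card W div 2)"
  have "m \<le> degree EW v + 1" if v: "v \<in> W" for v
  proof -
    have "{w. {v, w} \<in> EW} = {z \<in> W. {v, z} \<in> E}" unfolding EW_def using v by auto
    then have "degree EW v = card {z \<in> W. {v, z} \<in> E}" using degree_eq_card_neighbours[OF GW] by simp
    then show ?thesis using critical_degree[OF UW(5) v] unfolding m_def by simp
  qed
  moreover have "2 * m \<le> card W" unfolding m_def by simp
  ultimately obtain F K where FK: "simple_graph W F" "\<And>v. v \<in> W \<Longrightarrow> degree F v = degree EW v"
    "K \<subseteq> W" "card K = m" "clique K F"
    using exists_realization_with_clique[OF GW, of m] by metis
  define E' where "E' = {e \<in> E. \<not> e \<subseteq> W} \<union> F"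
  note repl = degree_replace_induced[OF assms WV(1) FK(1) FK(2)[unfolded EW_def], folded E'_def]
  have "clique (U \<union> K) E'"
    unfolding clique_def
  proof (intro ballI impI)
    fix a b assume ab: "a \<in> U \<union> K" "b \<in> U \<union> K" "a \<noteq> b"
    show "{a, b} \<in> E'"
    proof (cases "a \<in> K \<and> b \<in> K")
      case True
      then show ?thesis using FK(5) ab(3) unfolding clique_def E'_def by auto
    next
      case False
      \<comment> \<open>A pair not inside \<open>K\<close> meets \<open>U\<close>; it is an edge of
        \<open>E\<close> that survives because it is not contained in \<open>W\<close>.\<close>
      then have "{a, b} \<in> E"
        using ab UW(3,4) joined_sym[OF UW(4)] FK(3) unfolding clique_def joined_def by blast
      moreover have "\<not> {a, b} \<subseteq> W" using False ab UW(2) by auto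
      ultimately show ?thesis unfolding E'_def by auto
    qed
  qed
  then have "card (U \<union> K) \<le> seq_clique_number (degree_sequence V E')"
    using WV FK(3) by (intro seq_clique_number_ge repl(1)) auto
  moreover have "degree_sequence V E' = degree_sequence V E"
    using repl(2) fin by (intro degree_sequence_cong) auto
  moreover have "card (U \<union> K) = card U + m"
    using FK(3,4) UW(2) WV fin finite_subset by (subst card_Un_disjoint) (auto intro: finite_subset)
  ultimately have "card U + m \<le> seq_clique_number (degree_sequence V E)" by simp
  \<comment> \<open>If \<open>m = chi W\<close>, the clique has \<open>chi V\<close> vertices.
    Otherwise \<open>|W| \<le> 2 * m + 1\<close>, and
    \<open>5 * chi W \<le> 3 * |W| \<le> 6 * m + 3\<close>; the rounding is the source of the
    additive constant.\<close>
  moreover have "5 * chi V \<le> 6 * (card U + m) + 3"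
  proof (cases "chi W \<le> card W div 2")
    case True
    then show ?thesis using S(3) UW(6) unfolding m_def by simp
  next
    case False
    then have "m = card W div 2" unfolding m_def by simp
    then have "card W \<le> 2 * m + 1" by simp
    then have "5 * chi W \<le> 6 * m + 3" using UW(7) by simp
    then show ?thesis using S(3) UW(6) by simp
  qed
  moreover from calculation have "6 * (card U + m) \<le> 6 * seq_clique_number (degree_sequence V E)"
    by (simp only: mult_le_mono2)
  ultimately have "5 * chi V \<le> 6 * seq_clique_number (degree_sequence V E) + 3" by simp
  then have "real (5 * chi V) \<le> real (6 * seq_clique_number (degree_sequence V E) + 3)"
    by (simp only: of_nat_le_iff)
  then show ?thesis by simp
qed

end
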